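(* Let $k\geq1$. The following problem is in $\mathsf{TC}^k$ and it is hard for $\mathsf{AC}^k$ under $\mathsf{AC}^0$-Turing reductions. Input: a power circuit $(\Pi,\delta_\Pi)$ with $\mathrm{depth}(\Pi)\leq\log^k|\Pi|$ and nodes $A,B\in\Pi$ such that for all $P\in\Pi$ the marking $\Lambda_P$ is compact and for all $P\neq Q$ in $\Pi$, $\varepsilon(P)\neq\varepsilon(Q)$. Question: is $\varepsilon(A)\leq\varepsilon(B)$?
   Context: Power circuits. Let $\Gamma$ be a finite set and $\delta\colon\Gamma\times\Gamma\to\{-1,0,1\}$ such that the directed graph on $\Gamma$ with edge set $\{(P,Q):\delta(P,Q)\neq 0\}$ is acyclic (a dag). A marking on $\Gamma$ is a map $M\colon\Gamma\to\{-1,0,1\}$ with support $\sigma(M)=\{P:M(P)\neq0\}$. The successor marking of $P\in\Gamma$ is $\Lambda_P\colon Q\mapsto\delta(P,Q)$. The evaluation is defined bottom-up by $\varepsilon(P)=2^{\varepsilon(\Lambda_P)}$ for nodes and $\varepsilon(M)=\sum_{P}M(P)\varepsilon(P)$ for markings (the empty sum is $0$). $(\Gamma,\delta)$ is a power circuit if every node evaluates to an element of $\{2^n:n\in\mathbb{N}\}$. Size is $|\Gamma|$; depth is the number of edges of a longest path. A marking $M$ is compact if $|\varepsilon(\Lambda_P)-\varepsilon(\Lambda_Q)|\geq2$ for all $P\neq Q$ in $\sigma(M)$. Encoding: the matrix of $\delta$. Inputs are promised to satisfy the stated conditions. $\mathsf{AC}^k$ (resp. $\mathsf{TC}^k$)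 is the non-uniform class of problems decided by polynomial-size circuits of depth $O(\log^kn)$ with unbounded fan-in And, Or, Not (resp. And, Or, Not, Majority) gates. A problem $K$ is $\mathsf{AC}^0$-Turing reducible to $L$ if $K$ is decided by polynomial-size, constant-depth circuits with unbounded fan-in And, Or, Not gates and oracle gates for $L$. $\log$ is to base $2$ and $\log^k x=(\log x)^k$. *)

theory Defs
  imports Complex_Main "HOL-Library.Landau_Symbols"
begin

section \<open>Power circuits\<close>

definition pc_edges :: "'a set \<Rightarrow> ('a \<Rightarrow> 'a \<Rightarrow> int) \<Rightarrow> ('a \<times> 'a) set" where
  "pc_edges G \<delta> = {(P, Q). P \<in> G \<and> Q \<in> G \<and> \<delta> P Q \<noteq> 0}"

definition signed_dag :: "'a set \<Rightarrow> ('a \<Rightarrow> 'a \<Rightarrow> int) \<Rightarrow> bool" where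
  "signed_dag G \<delta> \<longleftrightarrow>
     finite G \<and> (\<forall>P\<in>G. \<forall>Q\<in>G. \<delta> P Q \<in> {-1, 0, 1}) \<and> acyclic (pc_edges G \<delta>)"

definition support :: "'a set \<Rightarrow> ('a \<Rightarrow> int) \<Rightarrow> 'a set" where
  "support G M = {P \<in> G. M P \<noteq> 0}"

definition succ_marking :: "('a \<Rightarrow> 'a \<Rightarrow> int) \<Rightarrow> 'a \<Rightarrow> ('a \<Rightarrow> int)" where
  "succ_marking \<delta> P = (\<lambda>Q. \<delta> P Q)"

text \<open>Evaluation is by well-founded recursion along the edges; see \<open>node_eval_eq\<close> below for the
  recursion equation.\<close>

definition node_eval :: "'a set \<Rightarrow> ('a \<Rightarrow> 'a \<Rightarrow> int) \<Rightarrow> 'a \<Rightarrow> real" where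
  "node_eval G \<delta> = wfrec ((pc_edges G \<delta>)\<inverse>)
     (\<lambda>e P. 2 powr (\<Sum>Q\<in>G. of_int (\<delta> P Q) * e Q))"

definition marking_eval :: "'a set \<Rightarrow> ('a \<Rightarrow> 'a \<Rightarrow> int) \<Rightarrow> ('a \<Rightarrow> int) \<Rightarrow> real" where
  "marking_eval G \<delta> M = (\<Sum>P\<in>G. of_int (M P) * node_eval G \<delta> P)"

lemma node_eval_eq:
  assumes "signed_dag G \<delta>" and "P \<in> G"
  shows "node_eval G \<delta> P = 2 powr marking_eval G \<delta> (succ_marking \<delta> P)"
proof -
  let ?R = "(pc_edges G \<delta>)\<inverse>"
  have "pc_edges G \<delta> \<subseteq> G \<times> G"
    by (auto simp: pc_edges_def)
  then have "finite (pc_edges G \<delta>)"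
    using assms(1) by (auto simp: signed_dag_def intro: finite_subset)
  then have "wf ?R"
    using assms(1) by (intro finite_acyclic_wf_converse) (auto simp: signed_dag_def)
  then have "node_eval G \<delta> P =
      2 powr (\<Sum>Q\<in>G. of_int (\<delta> P Q) * cut (node_eval G \<delta>) ?R P Q)"
    unfolding node_eval_def by (subst wfrec) simp_all
  also have "(\<Sum>Q\<in>G. of_int (\<delta> P Q) * cut (node_eval G \<delta>) ?R P Q)
      = marking_eval G \<delta> (succ_marking \<delta> P)"
    unfolding marking_eval_def succ_marking_def using assms(2)
    by (intro sum.cong) (auto simp: cut_def pc_edges_def)
  finally show ?thesis .
qed

definition power_circuit :: "'a set \<Rightarrow> ('a \<Rightarrow> 'a \<Rightarrow> int) \<Rightarrow> bool" where
  "power_circuit G \<delta> \<longleftrightarrow> signed_dag G \<delta> \<and> (\<forall>P\<in>G. node_eval G \<delta> P \<in> {2 ^ n | n :: nat. True})"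

definition pc_paths :: "'a set \<Rightarrow> ('a \<Rightarrow> 'a \<Rightarrow> int) \<Rightarrow> 'a list set" where
  "pc_paths G \<delta> = {p. p \<noteq> [] \<and> set p \<subseteq> G \<and> successively (\<lambda>P Q. (P, Q) \<in> pc_edges G \<delta>) p}"

definition pc_depth :: "'a set \<Rightarrow> ('a \<Rightarrow> 'a \<Rightarrow> int) \<Rightarrow> nat" where
  "pc_depth G \<delta> = (SUP p\<in>pc_paths G \<delta>. length p - 1)"

definition compact_marking :: "'a set \<Rightarrow> ('a \<Rightarrow> 'a \<Rightarrow> int) \<Rightarrow> ('a \<Rightarrow> int) \<Rightarrow> bool" where
  "compact_marking G \<delta> M \<longleftrightarrow>
     (\<forall>P\<in>support G M. \<forall>Q\<in>support G M. P \<noteq> Q \<longrightarrow>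
        \<bar>marking_eval G \<delta> (succ_marking \<delta> P) - marking_eval G \<delta> (succ_marking \<delta> Q)\<bar> \<ge> 2)"


section \<open>Boolean circuits\<close>

datatype gate_type = And_gate | Or_gate | Not_gate | Maj_gate | Oracle_gate

fun gate_fun :: "(bool list \<Rightarrow> bool) \<Rightarrow> gate_type \<Rightarrow> bool list \<Rightarrow> bool" where
  "gate_fun orc And_gate bs = (\<forall>b\<in>set bs. b)"
| "gate_fun orc Or_gate bs = (\<exists>b\<in>set bs. b)"
| "gate_fun orc Not_gate bs = (\<not> hd bs)"
| "gate_fun orc Maj_gate bs = (2 * count_list bs True > length bs)"
| "gate_fun orc Oracle_gate bs = orc bs"

text \<open>A circuit is a topologically sorted list of gates. The predecessors of a gate are given by
  their positions in the list; the last gate is the output gate.\<close>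

datatype gate = Input nat | Gate gate_type "nat list"

type_synonym circuit = "gate list"

definition wf_circuit :: "gate_type set \<Rightarrow> nat \<Rightarrow> circuit \<Rightarrow> bool" where
  "wf_circuit basis n C \<longleftrightarrow> C \<noteq> [] \<and>
     (\<forall>i<length C. case C ! i of
        Input j \<Rightarrow> j < n
      | Gate t ws \<Rightarrow> t \<in> basis \<and> (\<forall>w\<in>set ws. w < i) \<and> (t = Not_gate \<longrightarrow> length ws = 1))"

fun gate_value :: "(bool list \<Rightarrow> bool) \<Rightarrow> bool list \<Rightarrow> bool list \<Rightarrow> gate \<Rightarrow> bool" where
  "gate_value orc x vs (Input j) = x ! j"
| "gate_value orc x vs (Gate t ws) = gate_fun orc t (map (\<lambda>w. vs ! w) ws)"

definition circuit_output :: "(bool list \<Rightarrow> bool) \<Rightarrow> circuit \<Rightarrow> bool list \<Rightarrow> bool" where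
  "circuit_output orc C x = last (foldl (\<lambda>vs g. vs @ [gate_value orc x vs g]) [] C)"

fun gate_depth :: "nat list \<Rightarrow> gate \<Rightarrow> nat" where
  "gate_depth ds (Input j) = 0"
| "gate_depth ds (Gate t ws) = Suc (Max (insert 0 ((\<lambda>w. ds ! w) ` set ws)))"

definition circuit_depth :: "circuit \<Rightarrow> nat" where
  "circuit_depth C = Max (insert 0 (set (foldl (\<lambda>ds g. ds @ [gate_depth ds g]) [] C)))"

text \<open>Wires are counted as well as gates: predecessor lists may contain repetitions, so the number
  of gates alone would not bound the length of an oracle query.\<close>

fun gate_size :: "gate \<Rightarrow> nat" where
  "gate_size (Input j) = 1"
| "gate_size (Gate t ws) = 1 + length ws"

definition circuit_size :: "circuit \<Rightarrow> nat" where
  "circuit_size C = sum_list (map gate_size C)"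


section \<open>Promise problems and circuit classes\<close>

text \<open>Ordinary languages are the problems with promise \<open>UNIV\<close>. Membership in \<open>language\<close> matters
  only for inputs that satisfy the promise.\<close>

record problem =
  promise :: "bool list set"
  language :: "bool list set"

definition decides :: "(bool list \<Rightarrow> bool) \<Rightarrow> problem \<Rightarrow> bool" where
  "decides f K \<longleftrightarrow> (\<forall>x\<in>promise K. f x \<longleftrightarrow> x \<in> language K)"

definition family_output ::
    "(bool list \<Rightarrow> bool) \<Rightarrow> (nat \<Rightarrow> circuit) \<Rightarrow> bool list \<Rightarrow> bool" where
  "family_output orc F x = circuit_output orc (F (length x)) x"

text \<open>Polynomial size and depth \<open>O(log\<^sup>k n)\<close>; for \<open>k = 0\<close> the depth is constant.\<close>

definition circuit_family :: "gate_type set \<Rightarrow> nat \<Rightarrow> (nat \<Rightarrow> circuit) \<Rightarrow> bool" where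
  "circuit_family basis k F \<longleftrightarrow>
     (\<forall>n. wf_circuit basis n (F n)) \<and>
     (\<exists>c::nat. (\<lambda>n. real (circuit_size (F n))) \<in> O(\<lambda>n. real n ^ c)) \<and>
     (\<lambda>n. real (circuit_depth (F n))) \<in> O(\<lambda>n. (log 2 (real n)) ^ k)"

text \<open>The bases of \<open>AC\<close> and \<open>TC\<close> have no oracle gates, so the oracle passed here is never used.\<close>

definition AC :: "nat \<Rightarrow> problem set" where
  "AC k = {K. \<exists>F. circuit_family {And_gate, Or_gate, Not_gate} k F \<and>
                  decides (family_output (\<lambda>_. False) F) K}"

definition TC :: "nat \<Rightarrow> problem set" where
  "TC k = {K. \<exists>F. circuit_family {And_gate, Or_gate, Not_gate, Maj_gate} k F \<and>
                  decides (family_output (\<lambda>_. False) F) K}"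

text \<open>An oracle for a promise problem may answer arbitrarily outside the promise. A single family
  of circuits has to be correct for all such oracles.\<close>

definition AC0_Turing_reducible :: "problem \<Rightarrow> problem \<Rightarrow> bool" where
  "AC0_Turing_reducible K L \<longleftrightarrow>
     (\<exists>F. circuit_family {And_gate, Or_gate, Not_gate, Oracle_gate} 0 F \<and>
          (\<forall>orc. decides orc L \<longrightarrow> decides (family_output orc F) K))"

definition AC0_hard_for :: "problem set \<Rightarrow> problem \<Rightarrow> bool" where
  "AC0_hard_for \<C> L \<longleftrightarrow> (\<forall>K\<in>\<C>. AC0_Turing_reducible K L)"


section \<open>Comparing nodes in power circuits\<close>

text \<open>The nodes are \<open>0, \<dots>, n - 1\<close>, in no particular order. The matrix is written row by row with two
  bits per entry, followed by the characteristic vectors of the two nodes. The length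
  \<open>2 * n\<^sup>2 + 2 * n\<close> determines \<open>n\<close>.\<close>

definition encode_entry :: "int \<Rightarrow> bool list" where
  "encode_entry a = [a = 1, a = -1]"

definition encode_matrix :: "nat \<Rightarrow> (nat \<Rightarrow> nat \<Rightarrow> int) \<Rightarrow> bool list" where
  "encode_matrix n \<delta> =
     concat (map (\<lambda>P. concat (map (\<lambda>Q. encode_entry (\<delta> P Q)) [0..<n])) [0..<n])"

definition encode_node :: "nat \<Rightarrow> nat \<Rightarrow> bool list" where
  "encode_node n A = map (\<lambda>P. P = A) [0..<n]"

definition encode_instance :: "nat \<Rightarrow> (nat \<Rightarrow> nat \<Rightarrow> int) \<Rightarrow> nat \<Rightarrow> nat \<Rightarrow> bool list" where
  "encode_instance n \<delta> A B = encode_matrix n \<delta> @ encode_node n A @ encode_node n B"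

definition comparison_input ::
    "nat \<Rightarrow> 'a set \<Rightarrow> ('a \<Rightarrow> 'a \<Rightarrow> int) \<Rightarrow> 'a \<Rightarrow> 'a \<Rightarrow> bool" where
  "comparison_input k G \<delta> A B \<longleftrightarrow>
     power_circuit G \<delta> \<and>
     real (pc_depth G \<delta>) \<le> (log 2 (real (card G))) ^ k \<and>
     A \<in> G \<and> B \<in> G \<and>
     (\<forall>P\<in>G. compact_marking G \<delta> (succ_marking \<delta> P)) \<and>
     (\<forall>P\<in>G. \<forall>Q\<in>G. P \<noteq> Q \<longrightarrow> node_eval G \<delta> P \<noteq> node_eval G \<delta> Q)"

definition comparison_problem :: "nat \<Rightarrow> problem" where
  "comparison_problem k =
     \<lparr>promise = {encode_instance n \<delta> A B | n \<delta> A B. comparison_input k {..<n} \<delta> A B},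
      language = {encode_instance n \<delta> A B | n \<delta> A B. comparison_input k {..<n} \<delta> A B \<and>
                    node_eval {..<n} \<delta> A \<le> node_eval {..<n} \<delta> B}\<rparr>"

end

theory Submission
  imports Defs
begin

text \<open>
  The values of two distinct nodes are compared at the largest node on which their successor
  markings differ: exponents in a compact marking are at least 2 apart, so everything below this node
  contributes too little to matter. Hence the order on the nodes can be computed level by level,
  each level in constant depth, and the number of levels is the depth of the power circuit.

  For hardness, an \<open>AC\<close> circuit is turned into synchronous rounds of Nor gates. A Nor gate becomes
  the node with exponent \<open>B + p - \<Sum>u\<close>, where \<open>u\<close> runs over the nodes of its predecessors in the
  previous round, the small summand \<open>p\<close> makes the nodes distinct and \<open>B\<close> is an iterated power of two
  dominating everything else. A node is true if it exceeds a threshold node that evolves by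
  \<open>\<tau> \<mapsto> B + p - \<tau>\<close>: by the comparison rule the exponent stays above the threshold iff no predecessor is
  above the previous threshold.
\<close>

text \<open>The promise bounds the depth by \<open>log^k\<close> of the size with constant 1,
  whereas an \<open>AC\<close> family only has depth \<open>O(log^k n)\<close>. The instance is
  therefore padded to at least \<open>2^R\<close> nodes, and these must have pairwise distinct
  values. Naming them by subsets of a tower would take a tower of height \<open>R\<close>, which for
  \<open>k = 1\<close> costs as much depth as the padding gains. So the padding nodes are named by
  subsets of nodes that are themselves named by subsets of a tower of height about \<open>U\<close>,
  which is logarithmic in the size and depth of the simulated circuit. Distinctness also rules out
  fixed values for true and false; this is why truth is measured against a threshold of the same
  round. The input bits affect only the signs in a single column of the matrix, so one oracle query
  made of literals and constants suffices.\<close>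

section \<open>Comparison of compact markings\<close>

text \<open>The extreme case is the geometric series \<open>2^m + 2^(m-2) + ...\<close>, whose sum
  stays below \<open>4/3 * 2^m\<close>; the factor 3 keeps the bound free of fractions. Strong
  induction is used because removing the top term lowers the exponent by at least 2.\<close>

lemma sparse_sum_bound:
  fixes M :: "'a \<Rightarrow> int" and e :: "'a \<Rightarrow> nat"
  assumes "finite X" and "\<And>P. P \<in> X \<Longrightarrow> \<bar>M P\<bar> \<le> 1"
    and "\<And>P Q. \<lbrakk>P \<in> X; Q \<in> X; M P \<noteq> 0; M Q \<noteq> 0; P \<noteq> Q\<rbrakk> \<Longrightarrow> e P + 2 \<le> e Q \<or> e Q + 2 \<le> e P"
    and "\<And>P. \<lbrakk>P \<in> X; M P \<noteq> 0\<rbrakk> \<Longrightarrow> e P \<le> m"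
  shows "3 * \<bar>\<Sum>P\<in>X. of_int (M P) * 2 ^ e P\<bar> < (4 * 2 ^ m :: real)"
  using assms
proof (induction m arbitrary: X rule: less_induct)
  case (less m)
  let ?f = "\<lambda>P. of_int (M P) * 2 ^ e P :: real"
  define S where "S = {P \<in> X. M P \<noteq> 0}"
  show ?case
  proof (cases "S = {}")
    case True
    then have "(\<Sum>P\<in>X. ?f P) = 0"
      by (intro sum.neutral) (auto simp: S_def)
    then show ?thesis by simp
  next
    case False
    have fS: "finite S" using less.prems(1) by (simp add: S_def)
    have "Max (e ` S) \<in> e ` S" using fS False by simp
    then obtain t where t: "t \<in> S" "e t = Max (e ` S)" by auto
    have tX: "t \<in> X" "M t \<noteq> 0" using t by (auto simp: S_def)
    have top: "e Q + 2 \<le> e t" if "Q \<in> X - {t}" "M Q \<noteq> 0" for Q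
    proof -
      have "e Q \<le> e t" using that fS t by (simp add: S_def)
      then show ?thesis using less.prems(3)[of Q t] that tX by auto
    qed
    have rest: "3 * \<bar>\<Sum>P\<in>X - {t}. ?f P\<bar> < 2 ^ e t"
    proof (cases "2 \<le> e t")
      case True
      have "3 * \<bar>\<Sum>P\<in>X - {t}. ?f P\<bar> < 4 * 2 ^ (e t - 2)"
      proof (rule less.IH)
        show "e t - 2 < m" using True less.prems(4)[of t] tX by linarith
        show "e P \<le> e t - 2" if "P \<in> X - {t}" "M P \<noteq> 0" for P
          using top[OF that] by linarith
      qed (use less.prems in auto)
      also have "\<dots> = (2::real) ^ (2 + (e t - 2))" by (simp only: power_add) simp
      also have "2 + (e t - 2) = e t" using True by simp
      finally show ?thesis .
    next
      case False
      \<comment> \<open>A top exponent below 2 leaves no room for a second term.\<close>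
      have "(\<Sum>P\<in>X - {t}. ?f P) = 0"
        using top False by (intro sum.neutral) fastforce
      then show ?thesis by simp
    qed
    have "(\<Sum>P\<in>X. ?f P) = ?f t + (\<Sum>P\<in>X - {t}. ?f P)"
      using less.prems(1) tX by (intro sum.remove)
    moreover have "\<bar>?f t\<bar> \<le> 2 ^ e t"
    proof -
      have "\<bar>real_of_int (M t)\<bar> \<le> 1" using less.prems(2)[OF tX(1)] by linarith
      then show ?thesis by (simp add: abs_mult)
    qed
    moreover have "(2::real) ^ e t \<le> 2 ^ m"
      using less.prems(4) tX by (intro power_increasing) auto
    ultimately show ?thesis using rest by linarith
  qed
qed

text \<open>Passing from \<open>M\<close> to \<open>M'\<close> gains at least \<open>2 ^ e R\<close>
  at \<open>R\<close>. Below \<open>R\<close>, a sparse marking contributes less than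
  \<open>2/3 * 2 ^ e R\<close>, and less than \<open>1/3 * 2 ^ e R\<close> if \<open>R\<close> lies
  in its support. The coefficients at \<open>R\<close> differ, so at least one support contains
  \<open>R\<close>, and the lower parts together lose less than the gain.\<close>

lemma sparse_sum_less:
  fixes M M' :: "'a \<Rightarrow> int" and e :: "'a \<Rightarrow> nat"
  assumes fin: "finite X" and inj: "inj_on e X"
    and M: "\<And>P. P \<in> X \<Longrightarrow> \<bar>M P\<bar> \<le> 1" and M': "\<And>P. P \<in> X \<Longrightarrow> \<bar>M' P\<bar> \<le> 1"
    and sM: "\<And>P Q. \<lbrakk>P \<in> X; Q \<in> X; M P \<noteq> 0; M Q \<noteq> 0; P \<noteq> Q\<rbrakk> \<Longrightarrow> e P + 2 \<le> e Q \<or> e Q + 2 \<le> e P"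
    and sM': "\<And>P Q. \<lbrakk>P \<in> X; Q \<in> X; M' P \<noteq> 0; M' Q \<noteq> 0; P \<noteq> Q\<rbrakk> \<Longrightarrow> e P + 2 \<le> e Q \<or> e Q + 2 \<le> e P"
    and R: "R \<in> X" "M R < M' R"
    and above: "\<And>S. \<lbrakk>S \<in> X; e R < e S\<rbrakk> \<Longrightarrow> M S = M' S"
  shows "(\<Sum>P\<in>X. of_int (M P) * 2 ^ e P) < (\<Sum>P\<in>X. of_int (M' P) * 2 ^ e P :: real)"
proof -
  define B where "B = {P \<in> X. e P < e R}"
  define A where "A = {P \<in> X. e R < e P}"
  have X: "X = insert R (A \<union> B)"
    using R inj by (auto simp: A_def B_def inj_on_def) (metis less_linear)
  have split: "(\<Sum>P\<in>X. f P) = f R + (\<Sum>P\<in>A. f P) + (\<Sum>P\<in>B. f P)" for f :: "'a \<Rightarrow> real"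
  proof -
    have "(\<Sum>P\<in>X. f P) = f R + (\<Sum>P\<in>A \<union> B. f P)"
      by (subst X, rule sum.insert) (use fin in \<open>auto simp: A_def B_def\<close>)
    also have "(\<Sum>P\<in>A \<union> B. f P) = (\<Sum>P\<in>A. f P) + (\<Sum>P\<in>B. f P)"
      by (rule sum.union_disjoint) (use fin in \<open>auto simp: A_def B_def\<close>)
    finally show ?thesis by simp
  qed
  have A: "(\<Sum>P\<in>A. of_int (M P) * 2 ^ e P) = (\<Sum>P\<in>A. of_int (M' P) * 2 ^ e P :: real)"
    using above by (intro sum.cong) (auto simp: A_def)
  have low: "3 * \<bar>\<Sum>P\<in>B. of_int (N P) * 2 ^ e P\<bar> < (2 * 2 ^ e R :: real) \<and>
      (N R \<noteq> 0 \<longrightarrow> 3 * \<bar>\<Sum>P\<in>B. of_int (N P) * 2 ^ e P\<bar> < (2 ^ e R :: real))"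
    if N: "\<And>P. P \<in> X \<Longrightarrow> \<bar>N P\<bar> \<le> 1"
      and sN: "\<And>P Q. \<lbrakk>P \<in> X; Q \<in> X; N P \<noteq> 0; N Q \<noteq> 0; P \<noteq> Q\<rbrakk> \<Longrightarrow> e P + 2 \<le> e Q \<or> e Q + 2 \<le> e P"
    for N :: "'a \<Rightarrow> int"
  proof
    have fB: "finite B" "B \<subseteq> X" using fin by (auto simp: B_def)
    show "3 * \<bar>\<Sum>P\<in>B. of_int (N P) * 2 ^ e P\<bar> < (2 * 2 ^ e R :: real)"
    proof (cases "e R")
      case 0
      then have "B = {}" by (auto simp: B_def)
      then show ?thesis by simp
    next
      case (Suc m)
      have "3 * \<bar>\<Sum>P\<in>B. of_int (N P) * 2 ^ e P\<bar> < (4 * 2 ^ m :: real)"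
        by (rule sparse_sum_bound) (use fB N sN Suc in \<open>auto simp: B_def\<close>)
      then show ?thesis using Suc by simp
    qed
    show "N R \<noteq> 0 \<longrightarrow> 3 * \<bar>\<Sum>P\<in>B. of_int (N P) * 2 ^ e P\<bar> < (2 ^ e R :: real)"
    proof
      assume NR: "N R \<noteq> 0"
      have gap: "e P + 2 \<le> e R" if "P \<in> B" "N P \<noteq> 0" for P
        using sN[of P R] that NR R(1) by (auto simp: B_def)
      show "3 * \<bar>\<Sum>P\<in>B. of_int (N P) * 2 ^ e P\<bar> < (2 ^ e R :: real)"
      proof (cases "2 \<le> e R")
        case True
        have "3 * \<bar>\<Sum>P\<in>B. of_int (N P) * 2 ^ e P\<bar> < (4 * 2 ^ (e R - 2) :: real)"
        proof (rule sparse_sum_bound)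
          show "e P \<le> e R - 2" if "P \<in> B" "N P \<noteq> 0" for P
            using gap[OF that] by linarith
        qed (use fB N sN in \<open>auto simp: B_def\<close>)
        also have "\<dots> = (2::real) ^ (2 + (e R - 2))" by (simp only: power_add) simp
        also have "2 + (e R - 2) = e R" using True by simp
        finally show ?thesis .
      next
        case False
        have "(\<Sum>P\<in>B. of_int (N P) * 2 ^ e P) = (0::real)"
          using gap False by (intro sum.neutral) fastforce
        then show ?thesis by simp
      qed
    qed
  qed
  have lM: "3 * \<bar>\<Sum>P\<in>B. of_int (M P) * 2 ^ e P\<bar> < (2 * 2 ^ e R :: real) \<and>
      (M R \<noteq> 0 \<longrightarrow> 3 * \<bar>\<Sum>P\<in>B. of_int (M P) * 2 ^ e P\<bar> < (2 ^ e R :: real))"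
    by (rule low[OF M sM])
  have lM': "3 * \<bar>\<Sum>P\<in>B. of_int (M' P) * 2 ^ e P\<bar> < (2 * 2 ^ e R :: real) \<and>
      (M' R \<noteq> 0 \<longrightarrow> 3 * \<bar>\<Sum>P\<in>B. of_int (M' P) * 2 ^ e P\<bar> < (2 ^ e R :: real))"
    by (rule low[OF M' sM'])
  have MR: "M R \<noteq> 0 \<or> M' R \<noteq> 0" using R(2) by auto
  have "3 * \<bar>\<Sum>P\<in>B. of_int (M P) * 2 ^ e P\<bar> + 3 * \<bar>\<Sum>P\<in>B. of_int (M' P) * 2 ^ e P\<bar> < (3 * 2 ^ e R :: real)"
    using lM lM' MR by argo
  moreover have "of_int (M R) * 2 ^ e R + 2 ^ e R \<le> (of_int (M' R) * 2 ^ e R :: real)"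
  proof -
    have "real_of_int (M R) + 1 \<le> of_int (M' R)" using R(2) by linarith
    then have "(real_of_int (M R) + 1) * 2 ^ e R \<le> of_int (M' R) * 2 ^ e R"
      by (rule mult_right_mono) simp
    then show ?thesis by (simp add: algebra_simps)
  qed
  ultimately show ?thesis
    unfolding split A by linarith
qed

section \<open>Exponents and order of the nodes in reduced power circuits\<close>

lemma signed_dag_wf:
  assumes "signed_dag G \<delta>"
  shows "wf ((pc_edges G \<delta>)\<inverse>)"
proof -
  have "pc_edges G \<delta> \<subseteq> G \<times> G"
    by (auto simp: pc_edges_def)
  then have "finite (pc_edges G \<delta>)"
    using assms by (auto simp: signed_dag_def intro: finite_subset)
  then show ?thesis
    using assms by (intro finite_acyclic_wf_converse) (auto simp: signed_dag_def)
qed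

definition node_exp :: "'a set \<Rightarrow> ('a \<Rightarrow> 'a \<Rightarrow> int) \<Rightarrow> 'a \<Rightarrow> nat" where
  "node_exp G \<delta> P = nat \<lfloor>marking_eval G \<delta> (succ_marking \<delta> P)\<rfloor>"

lemma
  assumes "power_circuit G \<delta>" and "P \<in> G"
  shows succ_marking_eval: "marking_eval G \<delta> (succ_marking \<delta> P) = real (node_exp G \<delta> P)"
    and node_eval_exp: "node_eval G \<delta> P = 2 ^ node_exp G \<delta> P"
proof -
  obtain n :: nat where n: "node_eval G \<delta> P = 2 ^ n"
    using assms by (auto simp: power_circuit_def)
  have "2 powr marking_eval G \<delta> (succ_marking \<delta> P) = 2 powr real n"
    using node_eval_eq[of G \<delta> P] assms n by (simp add: power_circuit_def powr_realpow)
  then have "marking_eval G \<delta> (succ_marking \<delta> P) = real n"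
    by (simp add: powr_inj)
  then show "marking_eval G \<delta> (succ_marking \<delta> P) = real (node_exp G \<delta> P)"
    and "node_eval G \<delta> P = 2 ^ node_exp G \<delta> P"
    using n by (simp_all add: node_exp_def)
qed

text \<open>The promise of the comparison problem without the depth bound and the two query
  nodes.\<close>

definition reduced_circuit :: "'a set \<Rightarrow> ('a \<Rightarrow> 'a \<Rightarrow> int) \<Rightarrow> bool" where
  "reduced_circuit G \<delta> \<longleftrightarrow> power_circuit G \<delta> \<and>
     (\<forall>P\<in>G. compact_marking G \<delta> (succ_marking \<delta> P)) \<and>
     (\<forall>P\<in>G. \<forall>Q\<in>G. P \<noteq> Q \<longrightarrow> node_eval G \<delta> P \<noteq> node_eval G \<delta> Q)"

lemma reduced_circuit_entry:
  assumes "reduced_circuit G \<delta>" "P \<in> G" "Q \<in> G"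
  shows "\<delta> P Q \<in> {-1, 0, 1}"
  using assms by (auto simp: reduced_circuit_def power_circuit_def signed_dag_def)

text \<open>The right-hand side refers to node values only through their order, which turns the
  order into a recursion along the edges.\<close>

lemma node_eval_less_iff:
  assumes red: "reduced_circuit G \<delta>" and "P \<in> G" "Q \<in> G"
  shows "node_eval G \<delta> P < node_eval G \<delta> Q \<longleftrightarrow>
    (\<exists>R\<in>G. \<delta> P R < \<delta> Q R \<and> (\<forall>S\<in>G. node_eval G \<delta> R < node_eval G \<delta> S \<longrightarrow> \<delta> P S = \<delta> Q S))"
proof -
  let ?e = "node_exp G \<delta>"
  have pc: "power_circuit G \<delta>" and fin: "finite G"
    using red by (auto simp: reduced_circuit_def power_circuit_def signed_dag_def)
  note val = node_eval_exp[OF pc]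
  have inj: "inj_on ?e G"
    using red val by (fastforce simp: reduced_circuit_def inj_on_def)
  have less: "node_eval G \<delta> P < node_eval G \<delta> Q \<longleftrightarrow> ?e P < ?e Q" if "P \<in> G" "Q \<in> G" for P Q
    using val that by simp
  have sparse: "?e A + 2 \<le> ?e B \<or> ?e B + 2 \<le> ?e A"
    if "P \<in> G" "A \<in> G" "B \<in> G" "\<delta> P A \<noteq> 0" "\<delta> P B \<noteq> 0" "A \<noteq> B" for P A B
  proof -
    have "\<bar>real (?e A) - real (?e B)\<bar> \<ge> 2"
      using red that succ_marking_eval[OF pc]
      by (simp add: reduced_circuit_def compact_marking_def support_def succ_marking_def)
    then show ?thesis by linarith
  qed
  have sum: "real (?e P) = (\<Sum>R\<in>G. of_int (\<delta> P R) * 2 ^ ?e R)" if "P \<in> G" for P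
    using succ_marking_eval[OF pc that] val
    by (simp add: marking_eval_def succ_marking_def)
  have entry: "\<bar>\<delta> P R\<bar> \<le> 1" if "P \<in> G" "R \<in> G" for P R
    using reduced_circuit_entry[OF red that] by auto
  have mono: "?e P < ?e Q"
    if "P \<in> G" "Q \<in> G" "R \<in> G" "\<delta> P R < \<delta> Q R" "\<forall>S\<in>G. ?e R < ?e S \<longrightarrow> \<delta> P S = \<delta> Q S" for P Q R
  proof -
    have "real (?e P) < real (?e Q)"
      unfolding sum[OF that(1)] sum[OF that(2)]
      by (rule sparse_sum_less[where R = R, OF fin inj]) (use that entry sparse in auto)
    then show ?thesis by simp
  qed
  show ?thesis
  proof
    assume "node_eval G \<delta> P < node_eval G \<delta> Q"
    then have lt: "?e P < ?e Q" using less assms by simp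
    \<comment> \<open>The largest node in \<open>D\<close> decides; the reverse sign there would
      give the reverse inequality by \<open>mono\<close>.\<close>
    define D where "D = {R \<in> G. \<delta> P R \<noteq> \<delta> Q R}"
    have "D \<noteq> {}"
    proof
      assume "D = {}"
      then have "real (?e P) = real (?e Q)"
        unfolding sum[OF assms(2)] sum[OF assms(3)] by (intro sum.cong) (auto simp: D_def)
      then show False using lt by simp
    qed
    then have "Max (?e ` D) \<in> ?e ` D" using fin by (simp add: D_def)
    then obtain R where R: "R \<in> D" "?e R = Max (?e ` D)" by auto
    have above: "\<forall>S\<in>G. ?e R < ?e S \<longrightarrow> \<delta> P S = \<delta> Q S"
    proof (intro ballI impI, rule ccontr)
      fix S assume "S \<in> G" "?e R < ?e S" "\<delta> P S \<noteq> \<delta> Q S"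
      then have "?e S \<le> ?e R" using R fin by (simp add: D_def)
      then show False using \<open>?e R < ?e S\<close> by simp
    qed
    have RG: "R \<in> G" "\<delta> P R \<noteq> \<delta> Q R" using R by (auto simp: D_def)
    have "\<not> \<delta> Q R < \<delta> P R"
      using mono[of Q P R] RG above assms lt by fastforce
    then show "\<exists>R\<in>G. \<delta> P R < \<delta> Q R \<and>
        (\<forall>S\<in>G. node_eval G \<delta> R < node_eval G \<delta> S \<longrightarrow> \<delta> P S = \<delta> Q S)"
      using RG above less by (intro bexI[of _ R]) auto
  next
    assume "\<exists>R\<in>G. \<delta> P R < \<delta> Q R \<and>
        (\<forall>S\<in>G. node_eval G \<delta> R < node_eval G \<delta> S \<longrightarrow> \<delta> P S = \<delta> Q S)"
    then show "node_eval G \<delta> P < node_eval G \<delta> Q"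
      using mono less assms by (metis (no_types, lifting))
  qed
qed

text \<open>An encoded instance determines \<open>\<delta>\<close> only on pairs of nodes, so
  evaluation must not depend on the rest.\<close>

lemma node_eval_cong:
  assumes "signed_dag G \<delta>" and eq: "\<And>P Q. \<lbrakk>P \<in> G; Q \<in> G\<rbrakk> \<Longrightarrow> \<delta> P Q = \<delta>' P Q" and "P \<in> G"
  shows "node_eval G \<delta> P = node_eval G \<delta>' P"
proof -
  have E: "pc_edges G \<delta> = pc_edges G \<delta>'" using eq by (auto simp: pc_edges_def)
  have dag': "signed_dag G \<delta>'"
    using assms(1) eq E by (simp add: signed_dag_def)
  have "P \<in> G \<longrightarrow> node_eval G \<delta> P = node_eval G \<delta>' P"
  proof (induction P rule: wf_induct_rule[OF signed_dag_wf[OF assms(1)]])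
    case (1 P)
    show ?case
    proof
      assume P: "P \<in> G"
      have "marking_eval G \<delta> (succ_marking \<delta> P) = marking_eval G \<delta>' (succ_marking \<delta>' P)"
        unfolding marking_eval_def succ_marking_def
      proof (rule sum.cong)
        fix Q assume "Q \<in> G"
        then show "of_int (\<delta> P Q) * node_eval G \<delta> Q = of_int (\<delta>' P Q) * node_eval G \<delta>' Q"
          using 1[of Q] P eq[of P Q] by (cases "\<delta> P Q = 0") (auto simp: pc_edges_def)
      qed simp
      then show "node_eval G \<delta> P = node_eval G \<delta>' P"
        using node_eval_eq assms(1) dag' P by metis
    qed
  qed
  then show ?thesis using assms(3) by simp
qed

section \<open>Paths, depth, and computing the order level by level\<close>

lemma pc_path_trancl:
  assumes "P # p \<in> pc_paths G \<delta>" and "Q \<in> set p"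
  shows "(P, Q) \<in> (pc_edges G \<delta>)\<^sup>+"
  using assms
proof (induction p arbitrary: P)
  case (Cons R p)
  then have PR: "(P, R) \<in> pc_edges G \<delta>" and "R # p \<in> pc_paths G \<delta>"
    by (auto simp: pc_paths_def)
  then show ?case
    using Cons.IH[of R] Cons.prems(2) by (auto intro: trancl_into_trancl2)
qed simp

text \<open>By acyclicity a path repeats no node. The bound makes the set of lengths in
  \<open>pc_depth\<close> bounded, so that its supremum is an upper bound.\<close>

lemma pc_path_length_le_card:
  assumes "signed_dag G \<delta>" and "p \<in> pc_paths G \<delta>"
  shows "length p \<le> card G"
proof -
  have "distinct p"
    using assms(2)
  proof (induction p)
    case (Cons P p)
    have "P \<notin> set p"
      using pc_path_trancl[OF Cons.prems] assms(1) by (auto simp: signed_dag_def acyclic_def)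
    moreover have "distinct p"
      using Cons by (cases p) (auto simp: pc_paths_def)
    ultimately show ?case by simp
  qed simp
  moreover have "set p \<subseteq> G" "finite G"
    using assms by (auto simp: pc_paths_def signed_dag_def)
  ultimately show ?thesis
    by (metis card_mono distinct_card)
qed

lemma pc_path_length_le_depth:
  assumes "signed_dag G \<delta>" and "p \<in> pc_paths G \<delta>"
  shows "length p \<le> Suc (pc_depth G \<delta>)"
proof -
  have "bdd_above ((\<lambda>p. length p - 1) ` pc_paths G \<delta>)"
    using pc_path_length_le_card[OF assms(1)] by (intro bdd_aboveI[of _ "card G"]) fastforce
  then have "length p - 1 \<le> pc_depth G \<delta>"
    unfolding pc_depth_def by (rule cSUP_upper[OF assms(2)])
  then show ?thesis by simp
qed

lemma pc_depth_le:
  assumes "G \<noteq> {}" and "\<And>p. p \<in> pc_paths G \<delta> \<Longrightarrow> length p \<le> Suc d"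
  shows "pc_depth G \<delta> \<le> d"
proof -
  obtain P where "P \<in> G" using assms(1) by auto
  then have "[P] \<in> pc_paths G \<delta>" by (simp add: pc_paths_def)
  then show ?thesis
    unfolding pc_depth_def using assms(2) by (intro cSUP_least) fastforce+
qed

text \<open>Level \<open>l\<close> is correct on nodes from which all paths have at most \<open>l\<close> nodes, since only
  successors of \<open>P\<close> and \<open>Q\<close> contribute to the comparison of \<open>P\<close> and \<open>Q\<close>.\<close>

fun less_level :: "'a set \<Rightarrow> ('a \<Rightarrow> 'a \<Rightarrow> int) \<Rightarrow> nat \<Rightarrow> 'a \<Rightarrow> 'a \<Rightarrow> bool" where
  "less_level G \<delta> 0 P Q = False"
| "less_level G \<delta> (Suc l) P Q =
     (\<exists>R\<in>G. \<delta> P R < \<delta> Q R \<and> \<not> (\<exists>S\<in>G. less_level G \<delta> l R S \<and> \<delta> P S \<noteq> \<delta> Q S))"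

lemma less_level_correct:
  assumes red: "reduced_circuit G \<delta>" and "P \<in> G" "Q \<in> G"
    and "\<And>p. p \<in> pc_paths G \<delta> \<Longrightarrow> hd p \<in> {P, Q} \<Longrightarrow> length p \<le> l"
  shows "less_level G \<delta> l P Q \<longleftrightarrow> node_eval G \<delta> P < node_eval G \<delta> Q"
  using assms(2-)
proof (induction l arbitrary: P Q)
  case 0
  \<comment> \<open>Level 0 is vacuous: the one-node path from \<open>P\<close> already violates the
    assumption on path lengths.\<close>
  from "0.prems"(1) have "[P] \<in> pc_paths G \<delta>" by (simp add: pc_paths_def)
  then show ?case using "0.prems"(3)[of "[P]"] by simp
next
  case (Suc l)
  \<comment> \<open>Where the rows of \<open>P\<close> and \<open>Q\<close> differ, at least one of
    them has an edge; prepending that node to \<open>p\<close> uses up one of the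
    \<open>Suc l\<close> nodes.\<close>
  have short: "length p \<le> l"
    if "p \<in> pc_paths G \<delta>" "\<delta> P (hd p) \<noteq> \<delta> Q (hd p)" for p
  proof -
    have "p \<noteq> []" "hd p \<in> G" using that(1) by (cases p; simp add: pc_paths_def)+
    have "\<delta> P (hd p) \<noteq> 0 \<or> \<delta> Q (hd p) \<noteq> 0" using that(2) by auto
    then obtain X where X: "X \<in> {P, Q}" "\<delta> X (hd p) \<noteq> 0" by auto
    then have "X # p \<in> pc_paths G \<delta>"
      using that(1) \<open>p \<noteq> []\<close> \<open>hd p \<in> G\<close> Suc.prems(1,2)
      by (cases p) (auto simp: pc_paths_def pc_edges_def)
    then show ?thesis using Suc.prems(3)[of "X # p"] X by auto
  qed
  have IH: "less_level G \<delta> l R S \<longleftrightarrow> node_eval G \<delta> R < node_eval G \<delta> S"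
    if "R \<in> G" "S \<in> G" "\<delta> P R < \<delta> Q R" "\<delta> P S \<noteq> \<delta> Q S" for R S
  proof (rule Suc.IH[OF that(1,2)])
    fix p assume "p \<in> pc_paths G \<delta>" "hd p \<in> {R, S}"
    then show "length p \<le> l" using short[of p] that by auto
  qed
  show ?case
    unfolding node_eval_less_iff[OF red Suc.prems(1,2)] less_level.simps
    using IH by (metis (no_types, lifting))
qed

section \<open>Circuits as directed acyclic graphs\<close>

lemma length_foldl_snoc [simp]: "length (foldl (\<lambda>vs g. vs @ [f vs g]) [] C) = length C"
  by (induction C rule: rev_induct) auto

lemma take_foldl_snoc:
  "i \<le> length C \<Longrightarrow>
    take i (foldl (\<lambda>vs g. vs @ [f vs g]) [] C) = foldl (\<lambda>vs g. vs @ [f vs g]) [] (take i C)"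
proof (induction C rule: rev_induct)
  case (snoc g C)
  then show ?case by (cases "i = Suc (length C)") auto
qed simp

lemma nth_foldl_snoc:
  assumes "i < length C"
  shows "foldl (\<lambda>vs g. vs @ [f vs g]) [] C ! i =
    f (take i (foldl (\<lambda>vs g. vs @ [f vs g]) [] C)) (C ! i)"
proof -
  let ?F = "\<lambda>C. foldl (\<lambda>vs g. vs @ [f vs g]) [] C"
  have "?F C ! i = take (Suc i) (?F C) ! i" by simp
  also have "\<dots> = ?F (take (Suc i) C) ! i"
    using assms by (subst take_foldl_snoc) auto
  also have "\<dots> = f (?F (take i C)) (C ! i)"
    using assms by (simp add: take_Suc_conv_app_nth nth_append)
  also have "?F (take i C) = take i (?F C)"
    using assms by (subst take_foldl_snoc) auto
  finally show ?thesis .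
qed

definition circuit_values :: "(bool list \<Rightarrow> bool) \<Rightarrow> circuit \<Rightarrow> bool list \<Rightarrow> bool list" where
  "circuit_values orc C x = foldl (\<lambda>vs g. vs @ [gate_value orc x vs g]) [] C"

definition circuit_depths :: "circuit \<Rightarrow> nat list" where
  "circuit_depths C = foldl (\<lambda>ds g. ds @ [gate_depth ds g]) [] C"

lemma length_circuit_values [simp]: "length (circuit_values orc C x) = length C"
  by (simp add: circuit_values_def)

lemma length_circuit_depths [simp]: "length (circuit_depths C) = length C"
  by (simp add: circuit_depths_def)

lemma wf_circuit_wires:
  assumes "wf_circuit basis n C" "i < length C" "C ! i = Gate t ws" "w \<in> set ws"
  shows "w < i"
  using assms by (force simp: wf_circuit_def split: gate.splits)

text \<open>Wires point backwards, so the prefix known to the fold may be replaced by the complete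
  list. This turns the fold into a fixed-point equation.\<close>

lemma circuit_values_nth:
  assumes "wf_circuit basis n C" "i < length C"
  shows "circuit_values orc C x ! i = gate_value orc x (circuit_values orc C x) (C ! i)"
proof -
  have "gate_value orc x (take i (circuit_values orc C x)) (C ! i) =
      gate_value orc x (circuit_values orc C x) (C ! i)"
    using wf_circuit_wires[OF assms] by (cases "C ! i") (auto cong: map_cong)
  then show ?thesis
    using nth_foldl_snoc[OF assms(2), of "gate_value orc x"] by (simp add: circuit_values_def)
qed

lemma circuit_depths_nth:
  assumes "wf_circuit basis n C" "i < length C"
  shows "circuit_depths C ! i = gate_depth (circuit_depths C) (C ! i)"
proof -
  have "gate_depth (take i (circuit_depths C)) (C ! i) = gate_depth (circuit_depths C) (C ! i)"
    using wf_circuit_wires[OF assms] by (cases "C ! i") (auto cong: image_cong)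
  then show ?thesis
    using nth_foldl_snoc[OF assms(2), of gate_depth] by (simp add: circuit_depths_def)
qed

lemma circuit_output_nth:
  assumes "wf_circuit basis n C"
  shows "circuit_output orc C x = circuit_values orc C x ! (length C - 1)"
proof -
  have "circuit_values orc C x \<noteq> []"
    using assms length_circuit_values[of orc C x] by (auto simp: wf_circuit_def simp del: length_circuit_values)
  then show ?thesis
    by (simp add: circuit_output_def circuit_values_def[symmetric] last_conv_nth)
qed

lemma circuit_depth_ge:
  assumes "i < length C"
  shows "circuit_depths C ! i \<le> circuit_depth C"
  using assms by (auto simp: circuit_depth_def circuit_depths_def[symmetric] intro!: Max_ge)

lemma length_le_circuit_size: "length C \<le> circuit_size C"
proof (induction C)
  case (Cons g C)
  then show ?case by (cases g) (auto simp: circuit_size_def)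
qed (simp add: circuit_size_def)

text \<open>Gates are indexed by an arbitrary vertex type, so that circuits can be designed without
  list positions; \<open>circuit_of_dag\<close> flattens them.\<close>

datatype 'v dag_gate = DInput nat | DGate gate_type "'v list"

fun dag_gate_value :: "(bool list \<Rightarrow> bool) \<Rightarrow> bool list \<Rightarrow> ('v \<Rightarrow> bool) \<Rightarrow> 'v dag_gate \<Rightarrow> bool" where
  "dag_gate_value orc x val (DInput j) = x ! j"
| "dag_gate_value orc x val (DGate t ws) = gate_fun orc t (map val ws)"

fun dag_gate_size :: "'v dag_gate \<Rightarrow> nat" where
  "dag_gate_size (DInput j) = 1"
| "dag_gate_size (DGate t ws) = 1 + length ws"

text \<open>\<open>0 < rk v\<close> is demanded even of gates without predecessors: they have depth
  1, and the rank is to bound the depth.\<close>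

definition dag_gate_ok ::
    "gate_type set \<Rightarrow> nat \<Rightarrow> 'v set \<Rightarrow> ('v \<Rightarrow> nat) \<Rightarrow> ('v \<Rightarrow> 'v dag_gate) \<Rightarrow> 'v \<Rightarrow> bool" where
  "dag_gate_ok basis n V rk g v \<longleftrightarrow> (case g v of
      DInput j \<Rightarrow> j < n
    | DGate t ws \<Rightarrow> t \<in> basis \<and> 0 < rk v \<and> (\<forall>w\<in>set ws. w \<in> V \<and> rk w < rk v) \<and>
        (t = Not_gate \<longrightarrow> length ws = 1))"

text \<open>Listing the vertices by increasing rank is a topological sort. Since the graph is
  acyclic, any valuation that satisfies all gate equations is the computed one, so correctness of a
  circuit reduces to a local check of a guessed \<open>val\<close>.\<close>

lemma circuit_of_dag:
  fixes V :: "'v set" and g :: "'v \<Rightarrow> 'v dag_gate" and rk :: "'v \<Rightarrow> nat"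
  assumes fin: "finite V" and out: "out \<in> V"
    and ok: "\<And>v. v \<in> V \<Longrightarrow> dag_gate_ok basis n V rk g v"
    and top: "\<And>v. v \<in> V \<Longrightarrow> rk v \<le> rk out"
  obtains C where "wf_circuit basis n C"
    and "circuit_size C = (\<Sum>v\<in>V. dag_gate_size (g v))"
    and "circuit_depth C \<le> rk out"
    and "\<And>orc x val. (\<And>v. v \<in> V \<Longrightarrow> val v = dag_gate_value orc x val (g v)) \<Longrightarrow>
      circuit_output orc C x = val out"
proof -
  obtain us where us: "set us = V - {out}" "distinct us"
    using fin finite_distinct_list[of "V - {out}"] by auto
  \<comment> \<open>\<open>out\<close> is kept out of the sort: other vertices may share its rank,
    but the output must be the last gate.\<close>
  define vs where "vs = sort_key rk us @ [out]"
  have vs: "set vs = V" "distinct vs" "sorted (map rk vs)" "vs \<noteq> []" "vs ! (length vs - 1) = out"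
    using us out top by (auto simp: vs_def sorted_append nth_append)
  have "\<forall>v\<in>V. \<exists>i<length vs. vs ! i = v"
    using vs(1) by (auto simp: in_set_conv_nth[symmetric])
  then obtain pos where pos: "\<And>v. v \<in> V \<Longrightarrow> pos v < length vs \<and> vs ! pos v = v"
    by metis
  have inV: "vs ! i \<in> V" if "i < length vs" for i using that vs(1) by auto
  have earlier: "pos w < i" if "w \<in> V" "i < length vs" "rk w < rk (vs ! i)" for w i
  proof (rule ccontr)
    assume "\<not> pos w < i"
    then have "map rk vs ! i \<le> map rk vs ! pos w"
      using that pos by (intro sorted_nth_mono[OF vs(3)]) auto
    then show False using that pos by auto
  qed
  define C where "C = map (\<lambda>v. case g v of DInput j \<Rightarrow> Input j | DGate t ws \<Rightarrow> Gate t (map pos ws)) vs"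
  have len: "length C = length vs" by (simp add: C_def)
  have C_nth: "C ! i = (case g (vs ! i) of DInput j \<Rightarrow> Input j | DGate t ws \<Rightarrow> Gate t (map pos ws))"
    if "i < length vs" for i
    using that by (simp add: C_def)
  have wf: "wf_circuit basis n C"
    unfolding wf_circuit_def
  proof (intro conjI allI impI)
    show "C \<noteq> []" using vs by (simp add: C_def)
    fix i assume "i < length C"
    then have i: "i < length vs" by (simp add: len)
    show "case C ! i of Input j \<Rightarrow> j < n
        | Gate t ws \<Rightarrow> t \<in> basis \<and> (\<forall>w\<in>set ws. w < i) \<and> (t = Not_gate \<longrightarrow> length ws = 1)"
      using ok[OF inV[OF i]] earlier[OF _ i]
      by (auto simp: C_nth[OF i] dag_gate_ok_def split: dag_gate.splits)
  qed
  have "circuit_size C = sum_list (map (\<lambda>v. dag_gate_size (g v)) vs)"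
    unfolding circuit_size_def C_def map_map
    by (intro arg_cong[of _ _ sum_list] map_cong) (auto split: dag_gate.splits)
  then have size: "circuit_size C = (\<Sum>v\<in>V. dag_gate_size (g v))"
    using vs by (simp add: sum_list_distinct_conv_sum_set)
  have "circuit_depths C ! i \<le> rk (vs ! i)" if "i < length vs" for i
    using that
  proof (induction i rule: less_induct)
    case (less i)
    show ?case
    proof (cases "g (vs ! i)")
      case (DInput j)
      then show ?thesis using circuit_depths_nth[OF wf, of i] less.prems by (simp add: len C_nth)
    next
      case (DGate t ws)
      have "circuit_depths C ! pos w < rk (vs ! i)" if "w \<in> set ws" for w
      proof -
        have w: "w \<in> V" "rk w < rk (vs ! i)"
          using ok[OF inV[OF less.prems]] DGate that by (auto simp: dag_gate_ok_def)
        have "circuit_depths C ! pos w \<le> rk (vs ! pos w)"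
          using less.IH[of "pos w"] earlier[OF w(1) less.prems w(2)] pos[OF w(1)] by simp
        then show ?thesis using w pos by simp
      qed
      moreover have "0 < rk (vs ! i)"
        using ok[OF inV[OF less.prems]] DGate by (simp add: dag_gate_ok_def)
      ultimately show ?thesis
        using circuit_depths_nth[OF wf, of i] less.prems DGate by (simp add: len C_nth Suc_le_eq)
    qed
  qed
  then have "circuit_depths C ! i \<le> rk out" if "i < length vs" for i
    using that top inV order_trans by metis
  then have depth: "circuit_depth C \<le> rk out"
    by (auto simp: circuit_depth_def circuit_depths_def[symmetric] in_set_conv_nth len)
  have correct: "circuit_output orc C x = val out"
    if val: "\<And>v. v \<in> V \<Longrightarrow> val v = dag_gate_value orc x val (g v)" for orc x val
  proof -
    have "circuit_values orc C x ! i = val (vs ! i)" if "i < length vs" for i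
      using that
    proof (induction i rule: less_induct)
      case (less i)
      show ?case
      proof (cases "g (vs ! i)")
        case (DInput j)
        then show ?thesis
          using circuit_values_nth[OF wf, of i] less.prems val[OF inV] by (simp add: len C_nth)
      next
        case (DGate t ws)
        have "circuit_values orc C x ! pos w = val w" if "w \<in> set ws" for w
        proof -
          have w: "w \<in> V" "rk w < rk (vs ! i)"
            using ok[OF inV[OF less.prems]] DGate that by (auto simp: dag_gate_ok_def)
          then show ?thesis
            using less.IH[of "pos w"] earlier[OF w(1) less.prems w(2)] pos[OF w(1)] by simp
        qed
        then have "map ((!) (circuit_values orc C x) \<circ> pos) ws = map val ws" by simp
        then show ?thesis
          using circuit_values_nth[OF wf, of i] less.prems val[OF inV] DGate
          by (simp add: len C_nth del: map_eq_conv)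
      qed
    qed
    then show ?thesis
      using circuit_output_nth[OF wf] vs by (simp add: len)
  qed
  show ?thesis by (rule that[OF wf size depth]) (rule correct)
qed

section \<open>Encoding of instances\<close>

lemma length_concat_map_upt:
  assumes "\<And>i. i < n \<Longrightarrow> length (f i) = m"
  shows "length (concat (map f [0..<n])) = n * m"
  using assms by (induction n) auto

lemma nth_concat_map_upt:
  assumes "\<And>i. i < n \<Longrightarrow> length (f i) = m" and "i < n" and "j < m"
  shows "concat (map f [0..<n]) ! (i * m + j) = f i ! j"
  using assms
proof (induction n)
  case (Suc n)
  have len: "length (concat (map f [0..<n])) = n * m"
    using Suc.prems(1) by (intro length_concat_map_upt) simp
  show ?case
  proof (cases "i = n")
    case True
    then show ?thesis using len by (simp add: nth_append)
  next
    case False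
    then have "Suc i \<le> n" using Suc.prems(2) by simp
    then have "Suc i * m \<le> n * m" by (rule mult_le_mono1)
    then have "i * m + j < n * m" using Suc.prems(3) by simp
    then show ?thesis using len Suc False by (simp add: nth_append)
  qed
qed simp

definition entry_pos :: "nat \<Rightarrow> nat \<Rightarrow> nat \<Rightarrow> nat" where
  "entry_pos n P Q = P * (n * 2) + Q * 2"

lemma entry_pos_less:
  assumes "P < n" "Q < n"
  shows "Suc (entry_pos n P Q) < n * (n * 2)"
proof -
  have "Suc P * (n * 2) \<le> n * (n * 2)" using assms by (intro mult_le_mono1) simp
  then show ?thesis using assms by (simp add: entry_pos_def)
qed

definition instance_length :: "nat \<Rightarrow> nat" where
  "instance_length n = n * (n * 2) + n + n"

lemma length_encode_matrix: "length (encode_matrix n \<delta>) = n * (n * 2)"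
  unfolding encode_matrix_def by (simp add: length_concat_map_upt[where m = "n * 2"]
    length_concat_map_upt[where m = 2] encode_entry_def)

lemma length_encode_instance: "length (encode_instance n \<delta> A B) = instance_length n"
  by (simp add: encode_instance_def length_encode_matrix encode_node_def instance_length_def)

lemma encode_matrix_nth:
  assumes "P < n" "Q < n"
  shows "encode_matrix n \<delta> ! entry_pos n P Q = (\<delta> P Q = 1)"
    and "encode_matrix n \<delta> ! Suc (entry_pos n P Q) = (\<delta> P Q = -1)"
proof -
  let ?row = "\<lambda>P. concat (map (\<lambda>Q. encode_entry (\<delta> P Q)) [0..<n])"
  have row: "length (?row P) = n * 2" for P
    by (rule length_concat_map_upt) (simp add: encode_entry_def)
  have "encode_matrix n \<delta> ! (P * (n * 2) + (Q * 2 + j)) = encode_entry (\<delta> P Q) ! j" if "j < 2" for j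
  proof -
    have "encode_matrix n \<delta> ! (P * (n * 2) + (Q * 2 + j)) = ?row P ! (Q * 2 + j)"
      unfolding encode_matrix_def using assms row that by (intro nth_concat_map_upt) auto
    also have "\<dots> = encode_entry (\<delta> P Q) ! j"
      using assms that by (intro nth_concat_map_upt) (auto simp: encode_entry_def)
    finally show ?thesis .
  qed
  from this[of 0] this[of 1]
  show "encode_matrix n \<delta> ! entry_pos n P Q = (\<delta> P Q = 1)"
    and "encode_matrix n \<delta> ! Suc (entry_pos n P Q) = (\<delta> P Q = -1)"
    by (simp_all add: entry_pos_def encode_entry_def)
qed

lemma encode_instance_nth:
  assumes "P < n" "Q < n"
  shows "encode_instance n \<delta> A B ! entry_pos n P Q = (\<delta> P Q = 1)"
    and "encode_instance n \<delta> A B ! Suc (entry_pos n P Q) = (\<delta> P Q = -1)"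
    and "encode_instance n \<delta> A B ! (n * (n * 2) + P) = (P = A)"
    and "encode_instance n \<delta> A B ! (n * (n * 2) + n + P) = (P = B)"
proof -
  have "entry_pos n P Q < n * (n * 2)" "Suc (entry_pos n P Q) < n * (n * 2)"
    using entry_pos_less[OF assms] by simp_all
  then show "encode_instance n \<delta> A B ! entry_pos n P Q = (\<delta> P Q = 1)"
    and "encode_instance n \<delta> A B ! Suc (entry_pos n P Q) = (\<delta> P Q = -1)"
    by (simp_all add: encode_instance_def nth_append length_encode_matrix encode_matrix_nth assms)
  show "encode_instance n \<delta> A B ! (n * (n * 2) + P) = (P = A)"
    using assms by (simp add: encode_instance_def nth_append length_encode_matrix encode_node_def)
  have "n * (n * 2) + n + P - length (encode_matrix n \<delta>) - length (encode_node n A) = P"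
    by (simp add: length_encode_matrix encode_node_def)
  then show "encode_instance n \<delta> A B ! (n * (n * 2) + n + P) = (P = B)"
    using assms by (simp add: encode_instance_def nth_append length_encode_matrix encode_node_def)
qed

lemma instance_length_strict_mono: "strict_mono instance_length"
proof (rule strict_monoI)
  fix m n :: nat assume "m < n"
  then have "m * (m * 2) \<le> n * (n * 2)" by (intro mult_le_mono) auto
  then show "instance_length m < instance_length n"
    using \<open>m < n\<close> by (simp add: instance_length_def)
qed

lemma instance_length_eq_iff: "instance_length m = instance_length n \<longleftrightarrow> m = n"
  using strict_mono_eq[OF instance_length_strict_mono] .

text \<open>The two bits of an entry confuse 0 with entries outside {-1, 0, 1};
  \<open>signed_dag\<close> excludes the latter.\<close>

lemma encode_instance_inject:
  assumes eq: "encode_instance n \<delta> A B = encode_instance n' \<delta>' A' B'"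
    and red: "signed_dag {..<n} \<delta>" "signed_dag {..<n'} \<delta>'"
    and "A < n" "B < n" "A' < n'" "B' < n'"
  shows "n = n' \<and> A = A' \<and> B = B' \<and> (\<forall>P<n. \<forall>Q<n. \<delta> P Q = \<delta>' P Q)"
proof -
  have n: "n = n'"
    using length_encode_instance[of n \<delta> A B] length_encode_instance[of n' \<delta>' A' B'] eq
      instance_length_eq_iff by simp
  have "\<delta> P Q = \<delta>' P Q" if "P < n" "Q < n" for P Q
  proof -
    have "\<delta> P Q \<in> {-1, 0, 1}" "\<delta>' P Q \<in> {-1, 0, 1}"
      using red that n by (auto simp: signed_dag_def)
    then show ?thesis
      using encode_instance_nth(1,2)[OF that, of \<delta> A B] encode_instance_nth(1,2)[OF that, of \<delta>' A' B']
        eq n by auto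
  qed
  moreover have "A = A'" "B = B'"
    using encode_instance_nth(3)[of A n A \<delta> A B] encode_instance_nth(3)[of A n A \<delta>' A' B']
      encode_instance_nth(4)[of B n B \<delta> A B] encode_instance_nth(4)[of B n B \<delta>' A' B'] eq n assms
    by auto
  ultimately show ?thesis using n by simp
qed

lemma comparison_inputD:
  assumes "comparison_input k G \<delta> A B"
  shows "reduced_circuit G \<delta>" "signed_dag G \<delta>" "A \<in> G" "B \<in> G"
    "real (pc_depth G \<delta>) \<le> log 2 (real (card G)) ^ k"
  using assms by (auto simp: comparison_input_def reduced_circuit_def power_circuit_def)

text \<open>Membership is existential over all instances with the given code; injectivity on the
  nodes shows that every such witness has the same values.\<close>

lemma encode_instance_in_language:
  assumes "comparison_input k {..<n} \<delta> A B"
  shows "encode_instance n \<delta> A B \<in> language (comparison_problem k) \<longleftrightarrow>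
    node_eval {..<n} \<delta> A \<le> node_eval {..<n} \<delta> B"
proof
  assume "encode_instance n \<delta> A B \<in> language (comparison_problem k)"
  then obtain n' \<delta>' A' B' where eq: "encode_instance n \<delta> A B = encode_instance n' \<delta>' A' B'"
    and 1: "comparison_input k {..<n'} \<delta>' A' B'" "node_eval {..<n'} \<delta>' A' \<le> node_eval {..<n'} \<delta>' B'"
    by (auto simp: comparison_problem_def)
  have *: "n = n' \<and> A = A' \<and> B = B' \<and> (\<forall>P<n. \<forall>Q<n. \<delta> P Q = \<delta>' P Q)"
    using eq comparison_inputD[OF assms] comparison_inputD[OF 1(1)]
    by (intro encode_instance_inject) auto
  have "node_eval {..<n} \<delta> P = node_eval {..<n} \<delta>' P" if "P < n" for P
    using comparison_inputD[OF assms] * that by (intro node_eval_cong) auto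
  then show "node_eval {..<n} \<delta> A \<le> node_eval {..<n} \<delta> B"
    using 1(2) * comparison_inputD[OF assms] by simp
next
  assume "node_eval {..<n} \<delta> A \<le> node_eval {..<n} \<delta> B"
  then show "encode_instance n \<delta> A B \<in> language (comparison_problem k)"
    using assms by (auto simp: comparison_problem_def)
qed

section \<open>The comparison circuit\<close>

text \<open>For \<open>a\<close> and \<open>b\<close> in {-1, 0, 1}, \<open>a < b\<close> holds iff
  \<open>a = -1\<close> and \<open>b \<noteq> -1\<close>, or \<open>b = 1\<close> and
  \<open>a \<noteq> 1\<close>; these cases are \<open>VNeg\<close> and \<open>VPos\<close>.
  \<open>VWitness\<close> marks a node that decides a comparison, \<open>VClash\<close> a larger
  node that refutes it. \<open>VGreater\<close> is masked by the characteristic vectors of the query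
  nodes.\<close>

datatype cmp_vertex =
    VIn nat | VNot nat
  | VNeg nat nat nat | VPos nat nat nat | VLess nat nat nat | VDiffer nat nat nat
  | VLevel nat nat nat | VClash nat nat nat nat nat | VAnyClash nat nat nat nat
  | VNoClash nat nat nat nat | VWitness nat nat nat nat
  | VGreater nat nat | VAnyGreater | VOut

fun cmp_gate :: "nat \<Rightarrow> nat \<Rightarrow> cmp_vertex \<Rightarrow> cmp_vertex dag_gate" where
  "cmp_gate n T (VIn j) = DInput j"
| "cmp_gate n T (VNot j) = DGate Not_gate [VIn j]"
| "cmp_gate n T (VNeg P Q S) =
     DGate And_gate [VIn (Suc (entry_pos n P S)), VNot (Suc (entry_pos n Q S))]"
| "cmp_gate n T (VPos P Q S) = DGate And_gate [VIn (entry_pos n Q S), VNot (entry_pos n P S)]"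
| "cmp_gate n T (VLess P Q S) = DGate Or_gate [VNeg P Q S, VPos P Q S]"
| "cmp_gate n T (VDiffer P Q S) = DGate Or_gate [VLess P Q S, VLess Q P S]"
| "cmp_gate n T (VLevel l P Q) =
     DGate Or_gate (case l of 0 \<Rightarrow> [] | Suc l' \<Rightarrow> map (VWitness l' P Q) [0..<n])"
| "cmp_gate n T (VClash l P Q R S) = DGate And_gate [VLevel l R S, VDiffer P Q S]"
| "cmp_gate n T (VAnyClash l P Q R) = DGate Or_gate (map (VClash l P Q R) [0..<n])"
| "cmp_gate n T (VNoClash l P Q R) = DGate Not_gate [VAnyClash l P Q R]"
| "cmp_gate n T (VWitness l P Q R) = DGate And_gate [VLess P Q R, VNoClash l P Q R]"
| "cmp_gate n T (VGreater P Q) =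
     DGate And_gate [VIn (n * (n * 2) + P), VIn (n * (n * 2) + n + Q), VLevel T Q P]"
| "cmp_gate n T VAnyGreater = DGate Or_gate (concat (map (\<lambda>P. map (VGreater P) [0..<n]) [0..<n]))"
| "cmp_gate n T VOut = DGate Not_gate [VAnyGreater]"

text \<open>One level of the recursion passes through five layers: \<open>VLevel\<close>,
  \<open>VClash\<close>, \<open>VAnyClash\<close>, \<open>VNoClash\<close>, \<open>VWitness\<close>.
  Ranks below 5 belong to the comparison of matrix entries.\<close>

fun cmp_rank :: "nat \<Rightarrow> cmp_vertex \<Rightarrow> nat" where
  "cmp_rank T (VIn j) = 0"
| "cmp_rank T (VNot j) = 1"
| "cmp_rank T (VNeg P Q S) = 2"
| "cmp_rank T (VPos P Q S) = 2"
| "cmp_rank T (VLess P Q S) = 3"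
| "cmp_rank T (VDiffer P Q S) = 4"
| "cmp_rank T (VLevel l P Q) = 5 * l + 5"
| "cmp_rank T (VClash l P Q R S) = 5 * l + 6"
| "cmp_rank T (VAnyClash l P Q R) = 5 * l + 7"
| "cmp_rank T (VNoClash l P Q R) = 5 * l + 8"
| "cmp_rank T (VWitness l P Q R) = 5 * l + 9"
| "cmp_rank T (VGreater P Q) = 5 * T + 6"
| "cmp_rank T VAnyGreater = 5 * T + 7"
| "cmp_rank T VOut = 5 * T + 8"

fun cmp_bounded :: "nat \<Rightarrow> nat \<Rightarrow> cmp_vertex \<Rightarrow> bool" where
  "cmp_bounded n T (VIn j) = (j < instance_length n)"
| "cmp_bounded n T (VNot j) = (j < instance_length n)"
| "cmp_bounded n T (VNeg P Q S) = (P < n \<and> Q < n \<and> S < n)"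
| "cmp_bounded n T (VPos P Q S) = (P < n \<and> Q < n \<and> S < n)"
| "cmp_bounded n T (VLess P Q S) = (P < n \<and> Q < n \<and> S < n)"
| "cmp_bounded n T (VDiffer P Q S) = (P < n \<and> Q < n \<and> S < n)"
| "cmp_bounded n T (VLevel l P Q) = (l \<le> T \<and> P < n \<and> Q < n)"
| "cmp_bounded n T (VClash l P Q R S) = (l < T \<and> P < n \<and> Q < n \<and> R < n \<and> S < n)"
| "cmp_bounded n T (VAnyClash l P Q R) = (l < T \<and> P < n \<and> Q < n \<and> R < n)"
| "cmp_bounded n T (VNoClash l P Q R) = (l < T \<and> P < n \<and> Q < n \<and> R < n)"
| "cmp_bounded n T (VWitness l P Q R) = (l < T \<and> P < n \<and> Q < n \<and> R < n)"
| "cmp_bounded n T (VGreater P Q) = (P < n \<and> Q < n)"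
| "cmp_bounded n T VAnyGreater = True"
| "cmp_bounded n T VOut = True"

fun cmp_code :: "cmp_vertex \<Rightarrow> nat \<times> nat \<times> nat \<times> nat \<times> nat \<times> nat" where
  "cmp_code (VIn j) = (0, j, 0, 0, 0, 0)"
| "cmp_code (VNot j) = (1, j, 0, 0, 0, 0)"
| "cmp_code (VNeg P Q S) = (2, 0, P, Q, 0, S)"
| "cmp_code (VPos P Q S) = (3, 0, P, Q, 0, S)"
| "cmp_code (VLess P Q S) = (4, 0, P, Q, 0, S)"
| "cmp_code (VDiffer P Q S) = (5, 0, P, Q, 0, S)"
| "cmp_code (VLevel l P Q) = (6, l, P, Q, 0, 0)"
| "cmp_code (VClash l P Q R S) = (7, l, P, Q, R, S)"
| "cmp_code (VAnyClash l P Q R) = (8, l, P, Q, R, 0)"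
| "cmp_code (VNoClash l P Q R) = (9, l, P, Q, R, 0)"
| "cmp_code (VWitness l P Q R) = (10, l, P, Q, R, 0)"
| "cmp_code (VGreater P Q) = (11, 0, P, Q, 0, 0)"
| "cmp_code VAnyGreater = (12, 0, 0, 0, 0, 0)"
| "cmp_code VOut = (13, 0, 0, 0, 0, 0)"

lemma inj_cmp_code: "inj cmp_code"
proof (rule injI)
  fix v w assume "cmp_code v = cmp_code w"
  then show "v = w" by (cases v; cases w; simp)
qed

text \<open>A code consists of one of 14 tags and five indices below \<open>M\<close>. The summand 3
  in \<open>M\<close> serves \<open>cmp_gate_size\<close>: it covers the gates of constant
  fan-in.\<close>

lemma cmp_vertices_bound:
  assumes M: "M = instance_length n + T + 3"
  shows "finite (Collect (cmp_bounded n T))" and "card (Collect (cmp_bounded n T)) \<le> 14 * M ^ 5"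
proof -
  let ?X = "{..<14::nat} \<times> {..<M} \<times> {..<M} \<times> {..<M} \<times> {..<M} \<times> {..<M}"
  have "n \<le> instance_length n" by (simp add: instance_length_def)
  have sub: "cmp_code ` Collect (cmp_bounded n T) \<subseteq> ?X"
  proof (rule image_subsetI)
    fix v assume "v \<in> Collect (cmp_bounded n T)"
    then show "cmp_code v \<in> ?X"
      using \<open>n \<le> instance_length n\<close> by (cases v) (auto simp: M)
  qed
  have inj: "inj_on cmp_code (Collect (cmp_bounded n T))"
    using inj_cmp_code by (rule inj_on_subset) simp
  show "finite (Collect (cmp_bounded n T))"
    by (rule inj_on_finite[OF inj sub]) simp
  have "card (Collect (cmp_bounded n T)) \<le> card ?X"
    by (rule card_inj_on_le[OF inj sub]) simp
  then show "card (Collect (cmp_bounded n T)) \<le> 14 * M ^ 5"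
    by (simp add: eval_nat_numeral ac_simps)
qed

text \<open>The valuation to be supplied to \<open>circuit_of_dag\<close>.\<close>

fun cmp_value :: "nat \<Rightarrow> nat \<Rightarrow> (nat \<Rightarrow> nat \<Rightarrow> int) \<Rightarrow> nat \<Rightarrow> nat \<Rightarrow> cmp_vertex \<Rightarrow> bool" where
  "cmp_value n T \<delta> A B (VIn j) = encode_instance n \<delta> A B ! j"
| "cmp_value n T \<delta> A B (VNot j) = (\<not> encode_instance n \<delta> A B ! j)"
| "cmp_value n T \<delta> A B (VNeg P Q S) = (\<delta> P S = -1 \<and> \<delta> Q S \<noteq> -1)"
| "cmp_value n T \<delta> A B (VPos P Q S) = (\<delta> Q S = 1 \<and> \<delta> P S \<noteq> 1)"
| "cmp_value n T \<delta> A B (VLess P Q S) = (\<delta> P S < \<delta> Q S)"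
| "cmp_value n T \<delta> A B (VDiffer P Q S) = (\<delta> P S \<noteq> \<delta> Q S)"
| "cmp_value n T \<delta> A B (VLevel l P Q) = less_level {..<n} \<delta> l P Q"
| "cmp_value n T \<delta> A B (VClash l P Q R S) = (less_level {..<n} \<delta> l R S \<and> \<delta> P S \<noteq> \<delta> Q S)"
| "cmp_value n T \<delta> A B (VAnyClash l P Q R) =
     (\<exists>S<n. less_level {..<n} \<delta> l R S \<and> \<delta> P S \<noteq> \<delta> Q S)"
| "cmp_value n T \<delta> A B (VNoClash l P Q R) =
     (\<not> (\<exists>S<n. less_level {..<n} \<delta> l R S \<and> \<delta> P S \<noteq> \<delta> Q S))"
| "cmp_value n T \<delta> A B (VWitness l P Q R) =
     (\<delta> P R < \<delta> Q R \<and> \<not> (\<exists>S<n. less_level {..<n} \<delta> l R S \<and> \<delta> P S \<noteq> \<delta> Q S))"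
| "cmp_value n T \<delta> A B (VGreater P Q) = (P = A \<and> Q = B \<and> less_level {..<n} \<delta> T Q P)"
| "cmp_value n T \<delta> A B VAnyGreater = less_level {..<n} \<delta> T B A"
| "cmp_value n T \<delta> A B VOut = (\<not> less_level {..<n} \<delta> T B A)"

lemma cmp_value_eq:
  assumes v: "cmp_bounded n T v" and red: "reduced_circuit {..<n} \<delta>" and AB: "A < n" "B < n"
  shows "cmp_value n T \<delta> A B v =
    dag_gate_value orc (encode_instance n \<delta> A B) (cmp_value n T \<delta> A B) (cmp_gate n T v)"
proof (cases v)
  case (VLess P Q S)
  have "\<delta> P S \<in> {-1, 0, 1}" "\<delta> Q S \<in> {-1, 0, 1}"
    using reduced_circuit_entry[OF red] v VLess by auto
  then show ?thesis using VLess by auto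
next
  case (VLevel l P Q)
  then show ?thesis by (cases l) auto
qed (use v AB in \<open>auto simp: encode_instance_nth\<close>)

lemma cmp_gate_ok:
  assumes v: "cmp_bounded n T v"
  shows "dag_gate_ok {And_gate, Or_gate, Not_gate, Maj_gate} (instance_length n)
    (Collect (cmp_bounded n T)) (cmp_rank T) (cmp_gate n T) v"
proof -
  have pos: "entry_pos n P Q < instance_length n" "Suc (entry_pos n P Q) < instance_length n"
    if "P < n" "Q < n" for P Q
    using entry_pos_less[OF that] by (simp_all add: instance_length_def)
  have "n * (n * 2) + P < instance_length n" "n * (n * 2) + n + P < instance_length n" if "P < n" for P
    using that by (simp_all add: instance_length_def)
  with pos v show ?thesis
    by (cases v) (auto simp: dag_gate_ok_def split: nat.splits)
qed

lemma length_concat_map_map: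
  "length (concat (map (\<lambda>P. map (f P) [0..<n]) [0..<m])) = m * n"
  by (simp add: length_concat_map_upt[where m = n])

lemma cmp_gate_size:
  "dag_gate_size (cmp_gate n T v) \<le> 1 + (instance_length n + T + 3)"
  by (cases v) (auto simp: instance_length_def length_concat_map_map split: nat.splits)

lemma comparison_circuit:
  assumes M: "M = instance_length n + T + 3"
  obtains C where "wf_circuit {And_gate, Or_gate, Not_gate, Maj_gate} (instance_length n) C"
    and "circuit_size C \<le> 28 * M ^ 6" and "circuit_depth C \<le> 5 * T + 8"
    and "\<And>orc \<delta> A B. \<lbrakk>reduced_circuit {..<n} \<delta>; A < n; B < n; pc_depth {..<n} \<delta> < T\<rbrakk> \<Longrightarrow>
      circuit_output orc C (encode_instance n \<delta> A B) \<longleftrightarrow>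
        node_eval {..<n} \<delta> A \<le> node_eval {..<n} \<delta> B"
proof -
  let ?V = "Collect (cmp_bounded n T)"
  have top: "cmp_rank T v \<le> cmp_rank T VOut" if "v \<in> ?V" for v
    using that by (cases v) auto
  obtain C where C: "wf_circuit {And_gate, Or_gate, Not_gate, Maj_gate} (instance_length n) C"
      "circuit_size C = (\<Sum>v\<in>?V. dag_gate_size (cmp_gate n T v))"
      "circuit_depth C \<le> cmp_rank T VOut"
    and out: "\<And>orc x val. (\<And>v. v \<in> ?V \<Longrightarrow> val v = dag_gate_value orc x val (cmp_gate n T v)) \<Longrightarrow>
      circuit_output orc C x = val VOut"
    by (rule circuit_of_dag[of ?V VOut "{And_gate, Or_gate, Not_gate, Maj_gate}" "instance_length n"
        "cmp_rank T" "cmp_gate n T"])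
      (use cmp_vertices_bound(1)[OF M] cmp_gate_ok top in \<open>simp_all del: cmp_gate.simps cmp_rank.simps\<close>)
  have "circuit_size C \<le> (\<Sum>v\<in>?V. 1 + M)"
    unfolding C(2) M by (rule sum_mono) (rule cmp_gate_size)
  also have "\<dots> = card ?V * (1 + M)" by simp
  also have "\<dots> \<le> (14 * M ^ 5) * (2 * M)"
    using cmp_vertices_bound(2)[OF M] by (intro mult_le_mono) (auto simp: M)
  finally have size: "circuit_size C \<le> 28 * M ^ 6"
    using power_add[of M 5 1] by simp
  have correct: "circuit_output orc C (encode_instance n \<delta> A B) \<longleftrightarrow>
      node_eval {..<n} \<delta> A \<le> node_eval {..<n} \<delta> B"
    if red: "reduced_circuit {..<n} \<delta>" and AB: "A < n" "B < n" and d: "pc_depth {..<n} \<delta> < T"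
    for orc \<delta> A B
  proof -
    have dag: "signed_dag {..<n} \<delta>"
      using red by (simp add: reduced_circuit_def power_circuit_def)
    have "circuit_output orc C (encode_instance n \<delta> A B) = cmp_value n T \<delta> A B VOut"
      using cmp_value_eq[OF _ red AB] by (intro out) auto
    also have "\<dots> \<longleftrightarrow> \<not> less_level {..<n} \<delta> T B A" by simp
    also have "less_level {..<n} \<delta> T B A \<longleftrightarrow> node_eval {..<n} \<delta> B < node_eval {..<n} \<delta> A"
    proof (intro less_level_correct[OF red])
      \<comment> \<open>A path has one node more than edges, hence the strict bound on the
        depth.\<close>
      show "length p \<le> T" if "p \<in> pc_paths {..<n} \<delta>" for p
        using pc_path_length_le_depth[OF dag that] d by simp
    qed (use AB in auto)
    finally show ?thesis by auto
  qed
  show ?thesis using that[OF C(1) size _ correct] C(3) by simp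
qed

section \<open>Logarithmic bounds and the circuit family for membership in
  \<open>TC k\<close>\<close>

lemma log2_nat_nonneg: "0 \<le> log 2 (real n)"
  \<comment> \<open>The case \<open>n = 0\<close> rests on the convention
    \<open>ln 0 = 0\<close>.\<close>
  by (cases "n = 0") (auto simp: log_def)

lemma log2_nat_mono: "m \<le> n \<Longrightarrow> log 2 (real m) \<le> log 2 (real n)"
  using log2_nat_nonneg[of n] by (cases "m = 0") (simp_all add: log_def[of 2 0])

lemma log2_nat_le: "log 2 (real n) \<le> real n"
proof (cases "n = 0")
  case False
  then show ?thesis
    using log2_of_power_less[OF less_exp[of n]] by simp
qed (simp add: log_def)

lemma comparison_problem_in_TC: "comparison_problem k \<in> TC k"
proof -
  let ?basis = "{And_gate, Or_gate, Not_gate, Maj_gate}"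
  \<comment> \<open>The successor turns the promised bound on the depth into the strict one of
    \<open>comparison_circuit\<close>.\<close>
  define T where "T n = Suc (nat \<lfloor>log 2 (real n) ^ k\<rfloor>)" for n :: nat
  have T_le: "real (T n) \<le> log 2 (real n) ^ k + 1" for n
    using log2_nat_nonneg[of n] by (simp add: T_def)
  have "\<exists>C. wf_circuit ?basis (instance_length n) C \<and>
      circuit_size C \<le> 28 * (instance_length n + T n + 3) ^ 6 \<and> circuit_depth C \<le> 5 * T n + 8 \<and>
      (\<forall>orc \<delta> A B. reduced_circuit {..<n} \<delta> \<longrightarrow> A < n \<longrightarrow> B < n \<longrightarrow> pc_depth {..<n} \<delta> < T n \<longrightarrow>
        (circuit_output orc C (encode_instance n \<delta> A B) \<longleftrightarrow>
          node_eval {..<n} \<delta> A \<le> node_eval {..<n} \<delta> B))" for n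
    by (rule comparison_circuit[of "instance_length n + T n + 3" n "T n"]) blast+
  then obtain Cf where wf: "\<And>n. wf_circuit ?basis (instance_length n) (Cf n)"
    and size: "\<And>n. circuit_size (Cf n) \<le> 28 * (instance_length n + T n + 3) ^ 6"
    and depth: "\<And>n. circuit_depth (Cf n) \<le> 5 * T n + 8"
    and out: "\<And>n orc \<delta> A B. \<lbrakk>reduced_circuit {..<n} \<delta>; A < n; B < n; pc_depth {..<n} \<delta> < T n\<rbrakk> \<Longrightarrow>
      circuit_output orc (Cf n) (encode_instance n \<delta> A B) \<longleftrightarrow>
        node_eval {..<n} \<delta> A \<le> node_eval {..<n} \<delta> B"
    by metis
  \<comment> \<open>No instance has a length outside the range of \<open>instance_length\<close>, so
    any circuit will do there.\<close>
  define F where "F m = (if m \<in> range instance_length then Cf (the_inv instance_length m)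
    else [Gate And_gate []])" for m
  have F_inst: "F (instance_length n) = Cf n" for n
    using the_inv_f_f[OF strict_mono_imp_inj_on[OF instance_length_strict_mono]]
    by (simp add: F_def)
  have F_other: "F m = [Gate And_gate []]" if "m \<notin> range instance_length" for m
    using that by (simp add: F_def)
  have n_le: "n \<le> instance_length n" for n by (simp add: instance_length_def)
  have T_bound: "real (T n) \<le> real m ^ k + 1" "real (T n) \<le> log 2 (real m) ^ k + 1"
    if "n \<le> m" for n m
  proof -
    have "log 2 (real n) ^ k \<le> log 2 (real m) ^ k"
      using log2_nat_nonneg[of n] log2_nat_mono[OF that] by (intro power_mono)
    moreover have "log 2 (real m) ^ k \<le> real m ^ k"
      using log2_nat_nonneg[of m] log2_nat_le by (intro power_mono)
    ultimately show "real (T n) \<le> real m ^ k + 1" "real (T n) \<le> log 2 (real m) ^ k + 1"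
      using T_le[of n] by linarith+
  qed
  \<comment> \<open>The base 6 sums the coefficients of \<open>m + (m^k + 1) + 3\<close>, all powers
    being at most \<open>m^(k+1)\<close>; 28 and the outer exponent come from
    \<open>comparison_circuit\<close>.\<close>
  have size_F: "real (circuit_size (F m)) \<le> 28 * 6 ^ 6 * real m ^ (Suc k * 6)" if m: "m \<ge> 1" for m
  proof (cases "m \<in> range instance_length")
    case True
    then obtain n where n: "m = instance_length n" by auto
    have pow: "real m ^ j \<le> real m ^ Suc k" if "j \<le> Suc k" for j
      using m that by (intro power_increasing) auto
    have "real (m + T n + 3) \<le> real m + (real m ^ k + 1) + 3"
      using T_bound(1)[of n m] n_le n by simp
    also have "\<dots> \<le> 6 * real m ^ Suc k"
      using pow[of 1] pow[of k] pow[of 0] by simp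
    finally have M: "real (m + T n + 3) \<le> 6 * real m ^ Suc k" .
    have "real (circuit_size (F m)) \<le> real (28 * (m + T n + 3) ^ 6)"
      using size[of n] n F_inst[of n] by (simp only: of_nat_le_iff)
    also have "\<dots> = 28 * real (m + T n + 3) ^ 6" by simp
    also have "\<dots> \<le> 28 * (6 * real m ^ Suc k) ^ 6"
      using M by (intro mult_left_mono power_mono) auto
    also have "\<dots> = 28 * 6 ^ 6 * real m ^ (Suc k * 6)"
      by (simp only: power_mult_distrib power_mult[symmetric] mult.assoc)
    finally show ?thesis .
  next
    case False
    have "1 \<le> real m ^ (Suc k * 6)" using m by (intro one_le_power) simp
    then show ?thesis using F_other[OF False] by (simp add: circuit_size_def)
  qed
  \<comment> \<open>18 = 5 + 5 + 8: the depth is at most \<open>5 * (log^k m + 1) + 8\<close>, and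
    for \<open>m \<ge> 2\<close> the power of the logarithm is at least 1.\<close>
  have depth_F: "real (circuit_depth (F m)) \<le> 18 * log 2 (real m) ^ k" if m: "m \<ge> 2" for m
  proof -
    have "1 \<le> log 2 (real m)" using m by simp
    then have one: "1 \<le> log 2 (real m) ^ k" by (rule one_le_power)
    show ?thesis
    proof (cases "m \<in> range instance_length")
      case True
      then obtain n where n: "m = instance_length n" by auto
      have "real (circuit_depth (F m)) \<le> 5 * real (T n) + 8"
        using depth[of n] n F_inst[of n] by (simp flip: of_nat_le_iff)
      also have "\<dots> \<le> 18 * log 2 (real m) ^ k"
        using T_bound(2)[of n m] n_le n one by simp
      finally show ?thesis .
    next
      case False
      show ?thesis using F_other[OF False] one by (simp add: circuit_depth_def)
    qed
  qed
  have "circuit_family ?basis k F"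
    unfolding circuit_family_def
  proof (intro conjI allI exI)
    show "wf_circuit ?basis m (F m)" for m
    proof (cases "m \<in> range instance_length")
      case True
      then show ?thesis using wf F_inst by auto
    next
      case False
      then show ?thesis by (simp add: F_other wf_circuit_def)
    qed
    show "(\<lambda>m. real (circuit_size (F m))) \<in> O(\<lambda>m. real m ^ (Suc k * 6))"
      by (rule bigoI[of _ "28 * 6 ^ 6"], rule eventually_sequentiallyI[of 1]) (use size_F in auto)
    show "(\<lambda>m. real (circuit_depth (F m))) \<in> O(\<lambda>m. log 2 (real m) ^ k)"
      by (rule bigoI[of _ 18], rule eventually_sequentiallyI[of 2])
        (use depth_F log2_nat_nonneg in \<open>auto simp: power_abs\<close>)
  qed
  moreover have "decides (family_output (\<lambda>_. False) F) (comparison_problem k)"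
    unfolding decides_def
  proof
    fix x assume "x \<in> promise (comparison_problem k)"
    then obtain n \<delta> A B where x: "x = encode_instance n \<delta> A B"
      and inp: "comparison_input k {..<n} \<delta> A B"
      by (auto simp: comparison_problem_def)
    note D = comparison_inputD[OF inp]
    have "real (pc_depth {..<n} \<delta>) \<le> log 2 (real n) ^ k" using D(5) by simp
    then have "pc_depth {..<n} \<delta> < T n" by (simp add: T_def le_nat_floor less_Suc_eq_le)
    then show "family_output (\<lambda>_. False) F x \<longleftrightarrow> x \<in> language (comparison_problem k)"
      using out[of n \<delta> A B] D encode_instance_in_language[OF inp]
      by (simp add: family_output_def x length_encode_instance F_inst)
  qed
  ultimately show ?thesis by (auto simp: TC_def)
qed

section \<open>Power circuits built on a tower\<close>

text \<open>\<open>c\<close> is the tower of iterated powers of two. The last but one assumption isolates \<open>c 1\<close>, the only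
  node with an odd exponent; distinct even exponents are at least 2 apart, so compactness is automatic.\<close>

locale ranked_circuit =
  fixes G :: "'a set" and \<delta> :: "'a \<Rightarrow> 'a \<Rightarrow> int" and h :: "'a \<Rightarrow> nat" and c :: "nat \<Rightarrow> 'a"
  assumes finite_nodes: "finite G"
    and entry: "\<lbrakk>P \<in> G; Q \<in> G\<rbrakk> \<Longrightarrow> \<delta> P Q \<in> {-1, 0, 1}"
    and top: "\<lbrakk>P \<in> G; h P = Suc j\<rbrakk> \<Longrightarrow> c j \<in> G \<and> h (c j) = j \<and> \<delta> P (c j) = 1"
    and below: "\<lbrakk>P \<in> G; Q \<in> G; \<delta> P Q \<noteq> 0\<rbrakk> \<Longrightarrow> h Q < h P \<and> (Suc (h Q) = h P \<longrightarrow> Q = c (h Q))"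
    and bottom: "\<lbrakk>P \<in> G; Q \<in> G; \<delta> P Q \<noteq> 0; h Q \<le> 1\<rbrakk> \<Longrightarrow> h P = Suc (h Q)"
    and rows: "\<lbrakk>P \<in> G; Q \<in> G; P \<noteq> Q; h P = h Q\<rbrakk> \<Longrightarrow> \<exists>R\<in>G. \<delta> P R \<noteq> \<delta> Q R"
begin

abbreviation ev :: "'a \<Rightarrow> real" where
  "ev P \<equiv> marking_eval G \<delta> (succ_marking \<delta> P)"

abbreviation ex :: "'a \<Rightarrow> nat" where
  "ex P \<equiv> node_exp G \<delta> P"

lemma wf_edges: "wf ((pc_edges G \<delta>)\<inverse>)"
proof (rule wf_subset[OF wf_measure])
  show "(pc_edges G \<delta>)\<inverse> \<subseteq> measure h"
    using below by (auto simp: pc_edges_def)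
qed

lemma dag: "signed_dag G \<delta>"
  using finite_nodes entry wf_acyclic[OF wf_edges] by (simp add: signed_dag_def)

lemma path_length_le_rank:
  assumes "P # p \<in> pc_paths G \<delta>"
  shows "length p \<le> h P"
  using assms
proof (induction p arbitrary: P)
  case (Cons Q p)
  then have "(P, Q) \<in> pc_edges G \<delta>" and "Q # p \<in> pc_paths G \<delta>"
    by (auto simp: pc_paths_def)
  then show ?case
    using Cons.IH[of Q] below by (fastforce simp: pc_edges_def)
qed simp

text \<open>The clauses need a joint induction: integral exponents make the markings of the next
  rank sums of powers of two, distinctness makes these sums sparse, and sparseness yields order and
  distinctness at the next rank.\<close>

definition valid_below :: "nat \<Rightarrow> bool" where
  "valid_below m \<longleftrightarrow> (\<forall>P\<in>G. h P < m \<longrightarrow> ev P = real (ex P)) \<and>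
     (\<forall>P\<in>G. \<forall>Q\<in>G. h P < m \<longrightarrow> h Q < m \<longrightarrow>
        (h P < h Q \<longrightarrow> ex P < ex Q) \<and> (P \<noteq> Q \<longrightarrow> ex P \<noteq> ex Q))"

context
  fixes m :: nat
  assumes IH: "valid_below m"
begin

lemma ev_eq: "\<lbrakk>P \<in> G; h P < m\<rbrakk> \<Longrightarrow> ev P = real (ex P)"
  using IH by (simp add: valid_below_def)

lemma ex_less: "\<lbrakk>P \<in> G; Q \<in> G; h P < h Q; h Q < m\<rbrakk> \<Longrightarrow> ex P < ex Q"
  using IH by (auto simp: valid_below_def)

lemma ex_inj: "\<lbrakk>P \<in> G; Q \<in> G; h P < m; h Q < m; P \<noteq> Q\<rbrakk> \<Longrightarrow> ex P \<noteq> ex Q"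
  using IH by (auto simp: valid_below_def)

lemma ev_sum:
  assumes "P \<in> G" "h P \<le> m"
  shows "ev P = (\<Sum>Q\<in>{Q \<in> G. h Q < m}. of_int (\<delta> P Q) * 2 ^ ex Q)"
proof -
  have "ev P = (\<Sum>Q\<in>{Q \<in> G. h Q < m}. of_int (\<delta> P Q) * node_eval G \<delta> Q)"
    unfolding marking_eval_def succ_marking_def
    using below assms finite_nodes by (intro sum.mono_neutral_right) fastforce+
  also have "\<dots> = (\<Sum>Q\<in>{Q \<in> G. h Q < m}. of_int (\<delta> P Q) * 2 ^ ex Q)"
    using node_eval_eq[OF dag] ev_eq by (intro sum.cong) (auto simp: powr_realpow)
  finally show ?thesis .
qed

lemma ev_sum_int:
  assumes "P \<in> G" "h P \<le> m"
  shows "ev P = of_int (\<Sum>Q\<in>{Q \<in> G. h Q < m}. \<delta> P Q * 2 ^ ex Q)"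
  using ev_sum[OF assms] by simp

text \<open>Only nodes of rank 0 have value 1, and by \<open>bottom\<close> only nodes of rank 1
  have them as successors. All other summands are even.\<close>

lemma even_ex:
  assumes "P \<in> G" "h P < m" "h P \<noteq> 1"
  shows "even (ex P)"
proof -
  have "real_of_int (int (ex P)) = of_int (\<Sum>Q\<in>{Q \<in> G. h Q < m}. \<delta> P Q * 2 ^ ex Q)"
    using ev_sum_int[of P] ev_eq[of P] assms by simp
  then have "int (ex P) = (\<Sum>Q\<in>{Q \<in> G. h Q < m}. \<delta> P Q * 2 ^ ex Q)"
    by (simp only: of_int_eq_iff)
  moreover have "2 dvd \<delta> P Q * 2 ^ ex Q" if Q: "Q \<in> G" "h Q < m" for Q
  proof (cases "\<delta> P Q = 0 \<or> h Q = 0")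
    case True
    have "\<delta> P Q = 0"
    proof (rule ccontr)
      assume "\<delta> P Q \<noteq> 0"
      then show False using bottom[of P Q] assms Q True by simp
    qed
    then show ?thesis by simp
  next
    case False
    then obtain j where "h Q = Suc j" by (cases "h Q") auto
    then have "ex (c j) < ex Q" using top[of Q j] Q by (intro ex_less) auto
    then show ?thesis by simp
  qed
  ultimately have "2 dvd int (ex P)" by (auto intro: dvd_sum)
  then show ?thesis by presburger
qed

lemma sparse:
  assumes P: "P \<in> G" "h P \<le> m" and AB: "A \<in> G" "B \<in> G" "\<delta> P A \<noteq> 0" "\<delta> P B \<noteq> 0" "A \<noteq> B"
  shows "ex A + 2 \<le> ex B \<or> ex B + 2 \<le> ex A"
proof -
  have lt: "h A < m" "h B < m" using below[OF P(1)] AB P(2) by fastforce+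
  \<comment> \<open>A successor of rank 1 forces \<open>P\<close> to have rank 2; by
    \<open>bottom\<close> and \<open>below\<close>, its only successor is then
    \<open>c 1\<close>.\<close>
  have not1: "h A \<noteq> 1"
    if "A \<in> G" "B \<in> G" "\<delta> P A \<noteq> 0" "\<delta> P B \<noteq> 0" "A \<noteq> B" for A B
  proof
    assume A1: "h A = 1"
    then have P2: "h P = 2" using bottom[of P A] that P(1) by simp
    then have "h B < 2" using below[of P B] that P(1) by simp
    then have "h B = 1" using bottom[of P B] that P(1) P2 by simp
    then show False using below[of P A] below[of P B] that P(1) P2 A1 by auto
  qed
  have "even (ex A)" "even (ex B)"
    using even_ex[of A] even_ex[of B] not1[of A B] not1[of B A] AB lt by auto
  then obtain a b where "ex A = 2 * a" "ex B = 2 * b" by (auto elim!: evenE)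
  moreover have "ex A \<noteq> ex B" using ex_inj AB lt by simp
  ultimately show ?thesis by arith
qed

lemma inj_ex: "inj_on ex {Q \<in> G. h Q < m}"
  using ex_inj by (auto simp: inj_on_def)

lemma abs_entry: "\<lbrakk>P \<in> G; Q \<in> G\<rbrakk> \<Longrightarrow> \<bar>\<delta> P Q\<bar> \<le> 1"
  using entry[of P Q] by auto

lemma ev_less:
  assumes "P \<in> G" "Q \<in> G" "h P \<le> m" "h Q \<le> m" and R: "R \<in> G" "h R < m" "\<delta> P R < \<delta> Q R"
    and "\<And>S. \<lbrakk>S \<in> G; h S < m; ex R < ex S\<rbrakk> \<Longrightarrow> \<delta> P S = \<delta> Q S"
  shows "ev P < ev Q"
  unfolding ev_sum[OF assms(1,3)] ev_sum[OF assms(2,4)]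
  by (rule sparse_sum_less[where R = R, OF _ inj_ex])
    (use assms finite_nodes abs_entry sparse in auto)

text \<open>Besides \<open>c j\<close>, all successors of \<open>P\<close> have rank below
  \<open>j\<close>, and on ranks below \<open>m\<close> the exponents follow the rank.\<close>

lemma above_top:
  assumes "P \<in> G" "h P = Suc j" "h P \<le> m" and "S \<in> G" "ex (c j) < ex S"
  shows "\<delta> P S = 0"
proof (rule ccontr)
  assume "\<delta> P S \<noteq> 0"
  then have "h S < Suc j" "h S = j \<longrightarrow> S = c j" using below[of P S] assms by auto
  moreover have "c j \<in> G" "h (c j) = j" using top[of P j] assms by auto
  moreover have "h S < j \<longrightarrow> ex S < ex (c j)"
    using ex_less[of S "c j"] assms calculation by auto
  ultimately show False using assms(5) by (cases "h S = j") auto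
qed

lemma ev_nonneg:
  assumes P: "P \<in> G" "h P \<le> m"
  shows "0 \<le> ev P"
proof (cases "h P")
  case 0
  then have "\<not> \<delta> P Q \<noteq> 0" if "Q \<in> G" for Q
    using below[OF P(1) that] by auto
  then have "ev P = 0"
    unfolding ev_sum[OF P] by (intro sum.neutral) auto
  then show ?thesis by simp
next
  case (Suc j)
  \<comment> \<open>Comparison with the zero marking: the leading difference is the coefficient 1 at
    \<open>c j\<close>.\<close>
  have "(\<Sum>Q\<in>{Q \<in> G. h Q < m}. of_int 0 * 2 ^ ex Q) < ev P"
    unfolding ev_sum[OF P]
    by (rule sparse_sum_less[where R = "c j", OF _ inj_ex])
      (use P finite_nodes abs_entry sparse top[OF P(1) Suc] above_top[OF P(1) Suc P(2)] Suc in auto)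
  then show ?thesis by simp
qed

lemma valid_below_Suc: "valid_below (Suc m)"
proof -
  have ev: "ev P = real (ex P)" if "P \<in> G" "h P < Suc m" for P
  proof -
    have "h P \<le> m" using that by simp
    with ev_nonneg[OF that(1) this] ev_sum_int[OF that(1) this]
    obtain z where "ev P = of_int z" "0 \<le> ev P" by blast
    then show ?thesis by (simp add: node_exp_def)
  qed
  \<comment> \<open>The marking of \<open>Q\<close> leads with \<open>c j\<close> of rank
    \<open>j\<close>, while all successors of \<open>P\<close> have rank below
    \<open>j\<close>.\<close>
  have lt: "ex P < ex Q" if "P \<in> G" "Q \<in> G" "h P < Suc m" "h Q < Suc m" "h P < h Q" for P Q
  proof -
    have "h Q \<noteq> 0" using that by simp
    then obtain j where j: "h Q = Suc j" by (cases "h Q") auto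
    have "ev P < ev Q"
    proof (rule ev_less[where R = "c j"])
      show "\<delta> P (c j) < \<delta> Q (c j)"
        using below[of P "c j"] top[of Q j] that j by (cases "\<delta> P (c j) = 0") auto
      fix S assume S: "S \<in> G" "h S < m" "ex (c j) < ex S"
      have "\<delta> P S = 0"
      proof (rule ccontr)
        assume "\<delta> P S \<noteq> 0"
        then have "h S < j" using below[of P S] that j S by auto
        then have "ex S < ex (c j)"
          using ex_less[of S "c j"] top[of Q j] that j S by auto
        then show False using S by simp
      qed
      moreover have "\<delta> Q S = 0" using above_top[of Q j S] that j S by simp
      ultimately show "\<delta> P S = \<delta> Q S" by simp
    qed (use that j top[of Q j] in auto)
    then show ?thesis using ev that by simp
  qed
  have "ex P \<noteq> ex Q" if "P \<in> G" "Q \<in> G" "h P < Suc m" "h Q < Suc m" "P \<noteq> Q" for P Q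
  proof (cases "h P = h Q")
    case True
    \<comment> \<open>Within one rank, \<open>rows\<close> provides a difference, and the largest
      one decides.\<close>
    define D where "D = {R \<in> G. \<delta> P R \<noteq> \<delta> Q R}"
    have sub: "h R < m" if "R \<in> D" for R
      using below[of P R] below[of Q R] that \<open>P \<in> G\<close> \<open>Q \<in> G\<close> \<open>h P < Suc m\<close> \<open>h Q < Suc m\<close>
      by (fastforce simp: D_def)
    have fin: "finite D" using finite_nodes by (simp add: D_def)
    have "D \<noteq> {}" using rows[of P Q] that True by (auto simp: D_def)
    then have "Max (ex ` D) \<in> ex ` D" using fin by simp
    then obtain R where R: "R \<in> D" "ex R = Max (ex ` D)" by auto
    have above: "\<delta> P S = \<delta> Q S" if "S \<in> G" "ex R < ex S" for S
    proof (rule ccontr)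
      assume "\<delta> P S \<noteq> \<delta> Q S"
      then have "ex S \<le> ex R" using that R fin by (simp add: D_def)
      then show False using that by simp
    qed
    have "ev P \<noteq> ev Q"
    proof (cases "\<delta> P R < \<delta> Q R")
      case True
      then have "ev P < ev Q"
        using that R sub above by (intro ev_less[where R = R]) (auto simp: D_def)
      then show ?thesis by simp
    next
      case False
      then have "ev Q < ev P"
        using that R sub above by (intro ev_less[where R = R]) (auto simp: D_def)
      then show ?thesis by simp
    qed
    then show ?thesis using ev that by simp
  next
    case False
    then show ?thesis using lt[of P Q] lt[of Q P] that by (cases "h P < h Q") auto
  qed
  then show ?thesis using ev lt unfolding valid_below_def by blast
qed

end

lemma valid: "valid_below m"
proof (induction m)
  case 0
  show ?case by (simp add: valid_below_def)
next
  case (Suc m)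
  then show ?case by (rule valid_below_Suc)
qed

lemma node_eval_ex: "P \<in> G \<Longrightarrow> node_eval G \<delta> P = 2 ^ ex P"
  using node_eval_eq[OF dag, of P] ev_eq[OF valid[of "Suc (h P)"], of P] by (simp add: powr_realpow)

lemma node_eval_less: "\<lbrakk>P \<in> G; Q \<in> G; h P < h Q\<rbrakk> \<Longrightarrow> node_eval G \<delta> P < node_eval G \<delta> Q"
  using node_eval_ex ex_less[OF valid[of "Suc (h Q)"], of P Q] by simp

lemma reduced: "reduced_circuit G \<delta>"
proof -
  have "power_circuit G \<delta>"
    using dag node_eval_ex by (auto simp: power_circuit_def)
  moreover have "compact_marking G \<delta> (succ_marking \<delta> P)" if P: "P \<in> G" for P
    unfolding compact_marking_def
  proof (intro ballI impI)
    fix A B assume "A \<in> support G (succ_marking \<delta> P)" "B \<in> support G (succ_marking \<delta> P)" "A \<noteq> B"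
    then have AB: "A \<in> G" "B \<in> G" "\<delta> P A \<noteq> 0" "\<delta> P B \<noteq> 0" "A \<noteq> B"
      by (auto simp: support_def succ_marking_def)
    have "ex A + 2 \<le> ex B \<or> ex B + 2 \<le> ex A"
      by (rule sparse[OF valid[of "h P"] P _ AB]) simp
    moreover have "ev A = real (ex A)" "ev B = real (ex B)"
      using ev_eq[OF valid[of "Suc (h A)"]] ev_eq[OF valid[of "Suc (h B)"]] AB by auto
    ultimately show "\<bar>ev A - ev B\<bar> \<ge> 2" by linarith
  qed
  moreover have "node_eval G \<delta> P \<noteq> node_eval G \<delta> Q" if "P \<in> G" "Q \<in> G" "P \<noteq> Q" for P Q
    using ex_inj[OF valid[of "Suc (max (h P) (h Q))"], of P Q] that node_eval_ex by simp
  ultimately show ?thesis by (simp add: reduced_circuit_def)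
qed

lemma depth_le:
  assumes "G \<noteq> {}" and "\<And>P. P \<in> G \<Longrightarrow> h P \<le> d"
  shows "pc_depth G \<delta> \<le> d"
proof (rule pc_depth_le[OF assms(1)])
  fix p assume p: "p \<in> pc_paths G \<delta>"
  then obtain P p' where "p = P # p'" by (cases p) (auto simp: pc_paths_def)
  then show "length p \<le> Suc d"
    using path_length_le_rank[of P p'] p assms(2)[of P] by (auto simp: pc_paths_def)
qed

end

section \<open>Dual-rail simulation\<close>

locale circuit_iso =
  fixes f :: "'b \<Rightarrow> 'a" and G' :: "'b set" and G :: "'a set"
    and \<delta>' :: "'b \<Rightarrow> 'b \<Rightarrow> int" and \<delta> :: "'a \<Rightarrow> 'a \<Rightarrow> int"
  assumes bij: "bij_betw f G' G"
    and entry_eq: "\<lbrakk>P \<in> G'; Q \<in> G'\<rbrakk> \<Longrightarrow> \<delta>' P Q = \<delta> (f P) (f Q)"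
    and dag: "signed_dag G \<delta>"
begin

lemma f_in: "P \<in> G' \<Longrightarrow> f P \<in> G"
  using bij by (auto simp: bij_betw_def)

lemma f_eq_iff: "\<lbrakk>P \<in> G'; Q \<in> G'\<rbrakk> \<Longrightarrow> f P = f Q \<longleftrightarrow> P = Q"
  using bij by (auto simp: bij_betw_def inj_on_def)

lemma signed_dag_iso: "signed_dag G' \<delta>'"
proof -
  have "(pc_edges G' \<delta>')\<inverse> \<subseteq> inv_image ((pc_edges G \<delta>)\<inverse>) f"
    using entry_eq f_in by (auto simp: pc_edges_def)
  then have "wf ((pc_edges G' \<delta>')\<inverse>)"
    using signed_dag_wf[OF dag] by (blast intro: wf_subset wf_inv_image)
  moreover have "finite G'"
    using bij dag by (simp add: bij_betw_finite signed_dag_def)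
  moreover have "\<forall>P\<in>G'. \<forall>Q\<in>G'. \<delta>' P Q \<in> {-1, 0, 1}"
    using dag entry_eq f_in by (simp add: signed_dag_def)
  ultimately show ?thesis
    using wf_acyclic[of "(pc_edges G' \<delta>')\<inverse>"] by (simp add: signed_dag_def)
qed

lemma
  assumes "P \<in> G'"
  shows marking_eval_iso:
      "marking_eval G' \<delta>' (succ_marking \<delta>' P) = marking_eval G \<delta> (succ_marking \<delta> (f P))"
    and node_eval_iso: "node_eval G' \<delta>' P = node_eval G \<delta> (f P)"
proof -
  have step: "marking_eval G' \<delta>' (succ_marking \<delta>' P) = marking_eval G \<delta> (succ_marking \<delta> (f P))"
    if P: "P \<in> G'"
      and IH: "\<And>Q. \<lbrakk>Q \<in> G'; \<delta>' P Q \<noteq> 0\<rbrakk> \<Longrightarrow> node_eval G' \<delta>' Q = node_eval G \<delta> (f Q)" for P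
  proof -
    have "marking_eval G' \<delta>' (succ_marking \<delta>' P) =
        (\<Sum>Q\<in>G'. of_int (\<delta> (f P) (f Q)) * node_eval G \<delta> (f Q))"
      unfolding marking_eval_def succ_marking_def
    proof (rule sum.cong)
      fix Q assume "Q \<in> G'"
      then show "of_int (\<delta>' P Q) * node_eval G' \<delta>' Q = of_int (\<delta> (f P) (f Q)) * node_eval G \<delta> (f Q)"
        using IH[of Q] entry_eq[OF P, of Q] by (cases "\<delta>' P Q = 0") auto
    qed simp
    also have "\<dots> = marking_eval G \<delta> (succ_marking \<delta> (f P))"
      unfolding marking_eval_def succ_marking_def by (rule sum.reindex_bij_betw[OF bij])
    finally show ?thesis .
  qed
  have val: "P \<in> G' \<longrightarrow> node_eval G' \<delta>' P = node_eval G \<delta> (f P)" for P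
  proof (induction P rule: wf_induct_rule[OF signed_dag_wf[OF signed_dag_iso]])
    case (1 P)
    show ?case
    proof
      assume P: "P \<in> G'"
      have "marking_eval G' \<delta>' (succ_marking \<delta>' P) = marking_eval G \<delta> (succ_marking \<delta> (f P))"
      proof (rule step[OF P])
        fix Q assume "Q \<in> G'" "\<delta>' P Q \<noteq> 0"
        then show "node_eval G' \<delta>' Q = node_eval G \<delta> (f Q)"
          using 1[of Q] P by (simp add: pc_edges_def)
      qed
      then show "node_eval G' \<delta>' P = node_eval G \<delta> (f P)"
        using node_eval_eq[OF signed_dag_iso P] node_eval_eq[OF dag f_in[OF P]] by simp
    qed
  qed
  then show "node_eval G' \<delta>' P = node_eval G \<delta> (f P)" using assms by simp
  show "marking_eval G' \<delta>' (succ_marking \<delta>' P) = marking_eval G \<delta> (succ_marking \<delta> (f P))"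
    using step assms val by simp
qed

lemma reduced_circuit_iso:
  assumes "reduced_circuit G \<delta>"
  shows "reduced_circuit G' \<delta>'"
proof -
  have "power_circuit G' \<delta>'"
    using assms signed_dag_iso node_eval_iso f_in
    by (simp add: reduced_circuit_def power_circuit_def)
  moreover have "compact_marking G' \<delta>' (succ_marking \<delta>' P)" if P: "P \<in> G'" for P
  proof -
    have "compact_marking G \<delta> (succ_marking \<delta> (f P))"
      using assms f_in[OF P] by (simp add: reduced_circuit_def)
    moreover have "f Q \<in> support G (succ_marking \<delta> (f P))"
      if "Q \<in> support G' (succ_marking \<delta>' P)" for Q
      using that entry_eq[OF P, of Q] f_in by (simp add: support_def succ_marking_def)
    moreover have "Q \<in> G'" if "Q \<in> support G' (succ_marking \<delta>' P)" for Q
      using that by (simp add: support_def)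
    ultimately show ?thesis
      unfolding compact_marking_def using marking_eval_iso f_eq_iff by metis
  qed
  ultimately show ?thesis
    using assms node_eval_iso f_in f_eq_iff unfolding reduced_circuit_def by metis
qed

lemma pc_depth_iso:
  assumes "G' \<noteq> {}"
  shows "pc_depth G' \<delta>' \<le> pc_depth G \<delta>"
proof (rule pc_depth_le[OF assms])
  fix p assume p: "p \<in> pc_paths G' \<delta>'"
  have "successively (\<lambda>P Q. (f P, f Q) \<in> pc_edges G \<delta>) p"
    using p entry_eq f_in
    by (auto simp: pc_paths_def pc_edges_def elim!: successively_mono)
  then have "map f p \<in> pc_paths G \<delta>"
    using p f_in by (auto simp: pc_paths_def successively_map)
  then show "length p \<le> Suc (pc_depth G \<delta>)"
    using pc_path_length_le_depth[OF dag] by fastforce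
qed

end

text \<open>Dual-rail simulation of an \<open>AC\<close> circuit by synchronous rounds of Nor: vertex \<open>2 g + r\<close>
  carries the value of gate \<open>g\<close> for \<open>r = 1\<close> and its negation for \<open>r = 0\<close>.\<close>

definition rail :: "nat \<Rightarrow> bool \<Rightarrow> nat" where
  "rail g b = 2 * g + of_bool b"

text \<open>The first component is the rail that is computed directly from the predecessors, the second
  one the rail on which they are read.\<close>

fun gate_rails :: "gate_type \<Rightarrow> bool \<times> bool" where
  "gate_rails And_gate = (True, False)"
| "gate_rails Or_gate = (False, True)"
| "gate_rails _ = (True, True)"

text \<open>An And is the Nor of the negated predecessors, a negated Or is the Nor of the
  predecessors, and a Not is the Nor of its only predecessor. The remaining rail negates its
  partner. The rails of an input negate each other, so complementary values stay unchanged.\<close>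

definition rail_preds :: "circuit \<Rightarrow> nat \<Rightarrow> nat set" where
  "rail_preds C v = (let g = v div 2; b = odd v in
     case C ! g of Input j \<Rightarrow> {rail g (\<not> b)}
     | Gate t ws \<Rightarrow> if b = fst (gate_rails t) then (\<lambda>w. rail w (snd (gate_rails t))) ` set ws
         else {rail g (\<not> b)})"

definition rail_init :: "circuit \<Rightarrow> bool list \<Rightarrow> nat \<Rightarrow> bool" where
  "rail_init C x v = (case C ! (v div 2) of Input j \<Rightarrow> (x ! j = odd v) | Gate t ws \<Rightarrow> False)"

fun nor_rounds :: "(nat \<Rightarrow> nat set) \<Rightarrow> (nat \<Rightarrow> bool) \<Rightarrow> nat \<Rightarrow> nat \<Rightarrow> bool" where
  "nor_rounds pr ini 0 v = ini v"
| "nor_rounds pr ini (Suc l) v = (\<not> (\<exists>u\<in>pr v. nor_rounds pr ini l u))"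

lemma rail_simps [simp]: "rail g b div 2 = g" "odd (rail g b) = b"
  by (cases b; simp add: rail_def)+

lemma rail_preds_less:
  assumes wf: "wf_circuit basis n C" and v: "v < 2 * length C" and u: "u \<in> rail_preds C v"
  shows "u < 2 * length C"
proof -
  have g: "v div 2 < length C" using v by simp
  have rail_less: "rail w b < 2 * length C" if "w \<le> v div 2" for w b
    using that g by (cases b) (auto simp: rail_def)
  show ?thesis
  proof (cases "C ! (v div 2)")
    case (Input j)
    then show ?thesis using u rail_less by (simp add: rail_preds_def Let_def)
  next
    case (Gate t ws)
    then show ?thesis
      using u rail_less wf_circuit_wires[OF wf g Gate]
      by (auto simp: rail_preds_def Let_def less_imp_le split: if_splits)
  qed
qed

text \<open>Each layer costs two rounds, one for the rail computed from the predecessors and one for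
  its complement. As the claim covers all later rounds, gates of different depths can be combined
  without delays.\<close>

lemma nor_rounds_correct:
  assumes wf: "wf_circuit {And_gate, Or_gate, Not_gate} n C" and "g < length C"
    and "2 * circuit_depths C ! g \<le> l"
  shows "nor_rounds (rail_preds C) (rail_init C x) l (rail g b) \<longleftrightarrow>
    circuit_values orc C x ! g = b"
  using assms(2-)
proof (induction g arbitrary: l b rule: less_induct)
  case (less g)
  let ?N = "nor_rounds (rail_preds C) (rail_init C x)" and ?val = "\<lambda>g. circuit_values orc C x ! g"
  show ?case
  proof (cases "C ! g")
    case (Input j)
    have "?N l (rail g b) \<longleftrightarrow> ?val g = b" for l b
    proof (induction l arbitrary: b)
      case 0
      then show ?case
        using circuit_values_nth[OF wf less.prems(1)] Input by (simp add: rail_init_def)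
    next
      case (Suc l)
      then show ?case using Input by (auto simp: rail_preds_def)
    qed
    then show ?thesis .
  next
    case (Gate t ws)
    obtain p i where pi: "gate_rails t = (p, i)" by fastforce
    have t: "t \<in> {And_gate, Or_gate, Not_gate}" "t = Not_gate \<longrightarrow> length ws = 1"
      using wf less.prems(1) Gate by (force simp: wf_circuit_def split: gate.splits)+
    have dw: "circuit_depths C ! w < circuit_depths C ! g" if "w \<in> set ws" for w
      using circuit_depths_nth[OF wf less.prems(1)] Gate that by (auto simp: less_Suc_eq_le)
    have val: "?val g \<longleftrightarrow> (p \<longleftrightarrow> \<not> (\<exists>w\<in>set ws. ?val w = i))"
    proof -
      have "?val g = gate_fun orc t (map ?val ws)"
        using circuit_values_nth[OF wf less.prems(1)] Gate by simp
      then show ?thesis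
        using t pi by (cases t) (auto simp: length_Suc_conv)
    qed
    have dg: "1 \<le> circuit_depths C ! g"
      using circuit_depths_nth[OF wf less.prems(1)] Gate by simp
    \<comment> \<open>\<open>Suc l\<close>: the direct rail is correct one round earlier, which
      leaves a round for its complement.\<close>
    have direct: "?N l (rail g p) \<longleftrightarrow> ?val g = p" if l: "2 * circuit_depths C ! g \<le> Suc l" for l
    proof -
      obtain l' where l': "l = Suc l'" using l dg by (cases l) auto
      have "?N l' (rail w i) \<longleftrightarrow> ?val w = i" if "w \<in> set ws" for w
      proof (rule less.IH)
        show "w < g" using wf_circuit_wires[OF wf less.prems(1) Gate that] .
        then show "w < length C" using less.prems(1) by simp
        show "2 * circuit_depths C ! w \<le> l'" using dw[OF that] l l' by simp
      qed
      moreover have "rail_preds C (rail g p) = (\<lambda>w. rail w i) ` set ws"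
        using Gate pi by (simp add: rail_preds_def)
      ultimately have "?N l (rail g p) \<longleftrightarrow> \<not> (\<exists>w\<in>set ws. ?val w = i)"
        using l' by auto
      then show ?thesis using val by auto
    qed
    show ?thesis
    proof (cases "b = p")
      case True
      then show ?thesis using direct less.prems(2) by simp
    next
      case False
      obtain l' where l': "l = Suc l'" using less.prems(2) dg by (cases l) auto
      have "rail_preds C (rail g b) = {rail g p}"
        using Gate pi False by (simp add: rail_preds_def)
      then have "?N l (rail g b) \<longleftrightarrow> \<not> ?N l' (rail g p)" using l' by simp
      also have "\<dots> \<longleftrightarrow> ?val g = b" using direct[of l'] less.prems(2) l' False by auto
      finally show ?thesis .
    qed
  qed
qed

section \<open>Power circuits simulating Nor rounds\<close>

text \<open>\<open>Tow j\<close> is the \<open>j\<close>-th iterated power of two. \<open>Idn w\<close> encodes the binary expansion of \<open>w + 1\<close> over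
  the tower and serves to make the gate nodes distinct. \<open>Pad w\<close> does the same over the nodes \<open>Idn i\<close>;
  these are exponentially many nodes of constant additional depth. \<open>Gt l v\<close> is vertex \<open>v\<close> after \<open>l\<close>
  rounds, and \<open>v = W\<close> is the threshold.\<close>

datatype net_node = Tow nat | Idn nat | Pad nat | Gt nat nat

text \<open>The bounds provide a name \<open>Idn v\<close> for each vertex including the threshold,
  and a node \<open>Idn i\<close> for each of the \<open>R\<close> bits of a padding index.\<close>

locale nor_net =
  fixes U R L W :: nat and pr :: "nat \<Rightarrow> nat set" and ini :: "nat \<Rightarrow> bool"
  assumes W_less: "Suc W < 2 ^ U" and R_less: "R < 2 ^ U"
    and pr_less: "\<And>u v. \<lbrakk>v < W; u \<in> pr v\<rbrakk> \<Longrightarrow> u < W"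
begin

text \<open>\<open>below\<close> reserves the rank directly under a node for the tower, so
  \<open>Pad\<close> lies two ranks above \<open>Idn\<close>, and each round two above the previous
  one. The gap between \<open>Idn\<close> and \<open>Gt 0\<close> makes room for
  \<open>Tow (U + 4)\<close>, which exceeds all names and carries the initial value.\<close>

fun rank :: "net_node \<Rightarrow> nat" where
  "rank (Tow j) = j"
| "rank (Idn w) = U + 3"
| "rank (Pad w) = U + 5"
| "rank (Gt l v) = U + 7 + 2 * l"

definition nodes :: "net_node set" where
  "nodes = Tow ` {..U + 6 + 2 * L} \<union> Idn ` {..<2 ^ U - 1} \<union> Pad ` {..<2 ^ R - 1} \<union>
     (\<lambda>(l, v). Gt l v) ` ({..L} \<times> {..W})"

text \<open>Bits are shifted by 2 because \<open>bottom\<close> restricts the use of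
  \<open>Tow 0\<close> and \<open>Tow 1\<close>. \<open>Suc w\<close> has a nonempty set of bits,
  which keeps \<open>Idn w\<close> apart from the tower node of its rank. In round 0 the sign at
  \<open>Tow (U + 4)\<close> is the initial value; the threshold has 0 there, between the
  two.\<close>

fun entry :: "net_node \<Rightarrow> net_node \<Rightarrow> int" where
  "entry (Tow i) (Tow j) = of_bool (i = Suc j)"
| "entry (Idn w) (Tow j) = of_bool (j = U + 2 \<or> 2 \<le> j \<and> bit (Suc w) (j - 2))"
| "entry (Pad w) (Tow j) = of_bool (j = U + 4)"
| "entry (Pad w) (Idn i) = of_bool (bit (Suc w) i)"
| "entry (Gt l v) (Tow j) =
     (if j = U + 6 + 2 * l then 1
      else if l = 0 \<and> j = U + 4 \<and> v < W then (if ini v then 1 else -1) else 0)"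
| "entry (Gt l v) (Idn w) = of_bool (w = v)"
| "entry (Gt l v) (Gt l' u) =
     (if l = Suc l' \<and> (if v < W then u \<in> pr v else u = W) then -1 else 0)"
| "entry _ _ = 0"

lemma in_nodes [simp]:
  "Tow j \<in> nodes \<longleftrightarrow> j \<le> U + 6 + 2 * L" "Idn w \<in> nodes \<longleftrightarrow> Suc w < 2 ^ U"
  "Pad w \<in> nodes \<longleftrightarrow> Suc w < 2 ^ R" "Gt l v \<in> nodes \<longleftrightarrow> l \<le> L \<and> v \<le> W"
  by (auto simp: nodes_def)

lemma bit_less: "\<lbrakk>bit w i; w < 2 ^ n\<rbrakk> \<Longrightarrow> i < n" for w i n :: nat
proof (rule ccontr)
  assume "bit w i" "w < 2 ^ n" "\<not> i < n"
  then have "(2::nat) ^ n \<le> 2 ^ i" by (intro power_increasing) auto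
  then have "w div 2 ^ i = 0" using \<open>w < 2 ^ n\<close> by (intro div_less) linarith
  then show False using \<open>bit w i\<close> by (simp add: bit_iff_odd)
qed

lemma ex_bit: "\<exists>i. bit (Suc w) i"
  using bit_eqI[of "Suc w" 0] by auto

sublocale ranked_circuit nodes entry rank Tow
proof
  show "finite nodes" by (simp add: nodes_def)
next
  fix P Q assume "P \<in> nodes" "Q \<in> nodes"
  show "entry P Q \<in> {-1, 0, 1}" by (induction P Q rule: entry.induct) auto
next
  fix P j assume "P \<in> nodes" "rank P = Suc j"
  then show "Tow j \<in> nodes \<and> rank (Tow j) = j \<and> entry P (Tow j) = 1"
    by (cases P) auto
next
  fix P Q assume "P \<in> nodes" "Q \<in> nodes" "entry P Q \<noteq> 0"
  then show "rank Q < rank P \<and> (Suc (rank Q) = rank P \<longrightarrow> Q = Tow (rank Q))"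
    by (induction P Q rule: entry.induct) (auto split: if_splits dest: bit_less simp del: of_bool_or_iff)
next
  fix P Q assume "P \<in> nodes" "Q \<in> nodes" "entry P Q \<noteq> 0" "rank Q \<le> 1"
  then show "rank P = Suc (rank Q)"
    by (induction P Q rule: entry.induct) (auto split: if_splits)
next
  fix P Q assume PQ: "P \<in> nodes" "Q \<in> nodes" "P \<noteq> Q" "rank P = rank Q"
  have bits: "\<exists>i. bit (Suc w) i \<noteq> bit (Suc w') i" if "w \<noteq> w'" for w w'
    using that bit_eqI[of "Suc w" "Suc w'"] by auto
  \<comment> \<open>\<open>Tow i\<close> has no successor except the tower node under it; every
    other node of that rank has a further one.\<close>
  have tow: "\<exists>S\<in>nodes. entry P S \<noteq> entry Q S"
    if "P \<in> nodes" "Q = Tow i" "rank P = i" "P \<noteq> Q" for P Q i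
  proof (cases P)
    case (Idn w)
    obtain j where j: "bit (Suc w) j" using ex_bit by blast
    then have "j < U" using that Idn bit_less by auto
    then have "Tow (j + 2) \<in> nodes" "entry P (Tow (j + 2)) \<noteq> entry Q (Tow (j + 2))"
      using that Idn j by auto
    then show ?thesis by blast
  next
    case (Pad w)
    obtain j where j: "bit (Suc w) j" using ex_bit by blast
    then have "j < R" using that Pad bit_less by auto
    then have "Idn j \<in> nodes" using R_less by simp
    moreover have "entry P (Idn j) \<noteq> entry Q (Idn j)" using that Pad j by auto
    ultimately show ?thesis by blast
  next
    case (Gt l v)
    then have "Idn v \<in> nodes" using that W_less by auto
    moreover have "entry P (Idn v) \<noteq> entry Q (Idn v)" using that Gt by auto
    ultimately show ?thesis by blast
  qed (use that in auto)
  show "\<exists>S\<in>nodes. entry P S \<noteq> entry Q S"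
  proof (cases "(\<exists>i. P = Tow i) \<or> (\<exists>i. Q = Tow i)")
    case True
    then show ?thesis using tow[of P Q] tow[of Q P] PQ by force
  next
    case False
    then consider w w' where "P = Idn w" "Q = Idn w'" | w w' where "P = Pad w" "Q = Pad w'"
      | l v v' where "P = Gt l v" "Q = Gt l v'"
      using PQ(4) by (cases P; cases Q) auto
    then show ?thesis
    proof cases
      case 1
      then obtain j where j: "bit (Suc w) j \<noteq> bit (Suc w') j" using bits PQ by blast
      then have "j < U" using bit_less PQ 1 by auto
      then have "Tow (j + 2) \<in> nodes" "entry P (Tow (j + 2)) \<noteq> entry Q (Tow (j + 2))"
        using 1 j by auto
      then show ?thesis by blast
    next
      case 2
      then obtain j where j: "bit (Suc w) j \<noteq> bit (Suc w') j" using bits PQ by blast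
      then have "j < R" using bit_less PQ 2 by auto
      then have "Idn j \<in> nodes" "entry P (Idn j) \<noteq> entry Q (Idn j)"
        using 2 j R_less by auto
      then show ?thesis by blast
    next
      case 3
      then have "Idn v \<in> nodes" "entry P (Idn v) \<noteq> entry Q (Idn v)"
        using PQ W_less by auto
      then show ?thesis by blast
    qed
  qed
qed

abbreviation state :: "nat \<Rightarrow> nat \<Rightarrow> bool" where
  "state \<equiv> nor_rounds pr ini"

lemma node_eval_less_ifI:
  assumes "P \<in> nodes" "Q \<in> nodes" "S \<in> nodes" "entry P S < entry Q S"
    and "\<And>X. \<lbrakk>X \<in> nodes; entry P X \<noteq> entry Q X\<rbrakk> \<Longrightarrow>
      node_eval nodes entry X \<le> node_eval nodes entry S"
  shows "node_eval nodes entry P < node_eval nodes entry Q"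
  unfolding node_eval_less_iff[OF reduced assms(1,2)]
  using assms(3-) by (meson leD)

lemma state_correct:
  assumes "l \<le> L" "v < W"
  shows "if state l v then node_eval nodes entry (Gt l W) < node_eval nodes entry (Gt l v)
    else node_eval nodes entry (Gt l v) < node_eval nodes entry (Gt l W)"
  using assms
proof (induction l arbitrary: v)
  case 0
  \<comment> \<open>Apart from \<open>?S\<close>, the two rows differ only at names, which have
    smaller rank.\<close>
  let ?S = "Tow (U + 4)"
  have "node_eval nodes entry X \<le> node_eval nodes entry ?S"
    if "X \<in> nodes" "entry (Gt 0 v) X \<noteq> entry (Gt 0 W) X" for X
    using that 0 node_eval_less[of X ?S] by (cases X) (auto split: if_splits)
  then have le: "node_eval nodes entry X \<le> node_eval nodes entry ?S"
    if "X \<in> nodes" "entry (Gt 0 v) X \<noteq> entry (Gt 0 W) X" for X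
    using that by blast
  show ?case
  proof (cases "ini v")
    case True
    have "node_eval nodes entry (Gt 0 W) < node_eval nodes entry (Gt 0 v)"
    proof (rule node_eval_less_ifI[of _ _ ?S])
      fix X assume "X \<in> nodes" "entry (Gt 0 W) X \<noteq> entry (Gt 0 v) X"
      then show "node_eval nodes entry X \<le> node_eval nodes entry ?S" using le[of X] by metis
    qed (use 0 True in auto)
    then show ?thesis using True by simp
  next
    case False
    have "node_eval nodes entry (Gt 0 v) < node_eval nodes entry (Gt 0 W)"
      by (rule node_eval_less_ifI[of _ _ ?S]) (use 0 False le in auto)
    then show ?thesis using False by simp
  qed
next
  case (Suc l)
  let ?v = "Gt (Suc l) v" and ?t = "Gt (Suc l) W" and ?e = "node_eval nodes entry"
  have in_nodes': "?v \<in> nodes" "?t \<in> nodes" using Suc.prems by auto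
  have Idn_less: "?e (Idn w) < ?e (Gt l u)" if "Idn w \<in> nodes" "u \<le> W" for w u
    using that Suc.prems by (intro node_eval_less) auto
  have IH: "?e (Gt l W) < ?e (Gt l u) \<longleftrightarrow> state l u" "?e (Gt l u) < ?e (Gt l W) \<longleftrightarrow> \<not> state l u"
    if "u \<in> pr v" for u
    using Suc.IH[of u] Suc.prems pr_less[OF _ that] by (auto split: if_splits)
  have differ: "(\<exists>w. X = Idn w) \<or> (\<exists>u\<in>pr v. X = Gt l u) \<or> X = Gt l W"
    if "entry ?v X \<noteq> entry ?t X" for X
    using that Suc.prems by (cases X) (auto split: if_splits)
  show ?case
  proof (cases "\<exists>u\<in>pr v. state l u")
    case True
    \<comment> \<open>The largest predecessor exceeds the old threshold because a true one does. It
      is thus the largest node at which the rows differ, and it is subtracted only in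
      \<open>?v\<close>.\<close>
    let ?D = "pr v"
    have fin: "finite ?D"
      using pr_less[OF Suc.prems(2)] by (intro finite_subset[of ?D "{..<W}"]) auto
    have "?D \<noteq> {}" using True by auto
    then have "Max ((\<lambda>u. ?e (Gt l u)) ` ?D) \<in> (\<lambda>u. ?e (Gt l u)) ` ?D"
      using fin by simp
    then obtain u where u: "u \<in> pr v" "?e (Gt l u) = Max ((\<lambda>u. ?e (Gt l u)) ` ?D)"
      by auto
    have max: "?e (Gt l u') \<le> ?e (Gt l u)" if "u' \<in> pr v" for u'
      using u fin that by simp
    have uW: "u < W" using pr_less u Suc.prems by blast
    obtain u' where "u' \<in> pr v" "state l u'" using True by blast
    then have "?e (Gt l W) < ?e (Gt l u)" using IH(1)[of u'] max[of u'] by linarith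
    moreover have "?e ?v < ?e ?t"
    proof (rule node_eval_less_ifI[of _ _ "Gt l u"])
      fix X assume "X \<in> nodes" "entry ?v X \<noteq> entry ?t X"
      then show "?e X \<le> ?e (Gt l u)"
        using differ[of X] max Idn_less[of _ u] calculation uW by (auto intro: less_imp_le)
    qed (use in_nodes' Suc.prems uW u in auto)
    ultimately show ?thesis using True by simp
  next
    case False
    \<comment> \<open>All predecessors lie below the old threshold, which now decides; it is
      subtracted only in \<open>?t\<close>.\<close>
    have "?e ?t < ?e ?v"
    proof (rule node_eval_less_ifI[of _ _ "Gt l W"])
      show "entry ?t (Gt l W) < entry ?v (Gt l W)"
        using pr_less[of v W] Suc.prems by auto
      fix X assume "X \<in> nodes" "entry ?t X \<noteq> entry ?v X"
      then show "?e X \<le> ?e (Gt l W)"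
        using differ[of X] IH(2) False Idn_less[of _ W] by (auto intro: less_imp_le)
    qed (use in_nodes' Suc.prems in auto)
    then show ?thesis using False by simp
  qed
qed

lemma node_eval_threshold_le_iff:
  assumes "l \<le> L" "v < W"
  shows "node_eval nodes entry (Gt l W) \<le> node_eval nodes entry (Gt l v) \<longleftrightarrow> state l v"
  using state_correct[OF assms] by (auto split: if_splits)

lemma depth_nodes: "pc_depth nodes entry \<le> U + 7 + 2 * L"
proof (rule depth_le)
  show "nodes \<noteq> {}" using in_nodes(1)[of 0] by blast
  show "rank P \<le> U + 7 + 2 * L" if "P \<in> nodes" for P
    using that by (cases P) auto
qed

text \<open>There are \<open>2 ^ R - 1\<close> padding nodes; a tower node supplies the missing
  one.\<close>

lemma card_nodes_ge: "2 ^ R \<le> card nodes"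
proof -
  have "card (Pad ` {..<2 ^ R - 1}) = 2 ^ R - 1"
    by (subst card_image) (simp_all add: inj_on_def)
  then have "card (insert (Tow 0) (Pad ` {..<2 ^ R - 1})) = Suc (2 ^ R - 1)"
    by (subst card_insert_disjoint) auto
  moreover have "card (insert (Tow 0) (Pad ` {..<2 ^ R - 1})) \<le> card nodes"
    using finite_nodes by (rule card_mono) (auto simp: nodes_def)
  moreover have "Suc (2 ^ R - 1) = 2 ^ R" by simp
  ultimately show ?thesis by linarith
qed

lemma card_nodes_le: "card nodes \<le> (U + 7 + 2 * L) + 2 ^ U + 2 ^ R + Suc L * Suc W"
proof -
  let ?T = "Tow ` {..U + 6 + 2 * L}" and ?I = "Idn ` {..<2 ^ U - 1}"
    and ?P = "Pad ` {..<2 ^ R - 1}" and ?G = "(\<lambda>(l, v). Gt l v) ` ({..L} \<times> {..W})"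
  have "card nodes \<le> card (?T \<union> ?I \<union> ?P) + card ?G"
    unfolding nodes_def by (rule card_Un_le)
  moreover have "card (?T \<union> ?I \<union> ?P) \<le> card (?T \<union> ?I) + card ?P" by (rule card_Un_le)
  moreover have "card (?T \<union> ?I) \<le> card ?T + card ?I" by (rule card_Un_le)
  moreover have "card ?T \<le> U + 7 + 2 * L"
    using card_image_le[of "{..U + 6 + 2 * L}" Tow] by simp
  moreover have "card ?I \<le> 2 ^ U"
    using card_image_le[of "{..<2 ^ U - 1}" Idn] by simp
  moreover have "card ?P \<le> 2 ^ R"
    using card_image_le[of "{..<2 ^ R - 1}" Pad] by simp
  moreover have "card ?G \<le> Suc L * Suc W"
    using card_image_le[of "{..L} \<times> {..W}" "\<lambda>(l, v). Gt l v"] by simp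
  ultimately show ?thesis by linarith
qed

end

section \<open>The reduction\<close>

datatype literal = LIn nat | LNot nat | LConst bool

fun literal_value :: "bool list \<Rightarrow> literal \<Rightarrow> bool" where
  "literal_value x (LIn j) = x ! j"
| "literal_value x (LNot j) = (\<not> x ! j)"
| "literal_value x (LConst b) = b"

fun literal_gate :: "literal \<Rightarrow> literal option dag_gate" where
  "literal_gate (LIn j) = DInput j"
| "literal_gate (LNot j) = DGate Not_gate [Some (LIn j)]"
| "literal_gate (LConst b) = DGate (if b then And_gate else Or_gate) []"

definition literals :: "nat \<Rightarrow> literal set" where
  "literals n = LIn ` {..<n} \<union> LNot ` {..<n} \<union> {LConst True, LConst False}"

text \<open>At most \<open>2 * n + 2\<close> literal gates of size at most 2 feed a single oracle
  gate of size \<open>1 + length ls\<close>.\<close>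

lemma oracle_circuit:
  assumes "set ls \<subseteq> literals n"
  obtains C where "wf_circuit {And_gate, Or_gate, Not_gate, Oracle_gate} n C"
    and "circuit_size C \<le> 4 * n + 5 + length ls" and "circuit_depth C \<le> 2"
    and "\<And>orc x. circuit_output orc C x = orc (map (literal_value x) ls)"
proof -
  let ?basis = "{And_gate, Or_gate, Not_gate, Oracle_gate}"
  define g where "g v = (case v of None \<Rightarrow> DGate Oracle_gate (map Some ls) | Some l \<Rightarrow> literal_gate l)" for v
  define rk :: "literal option \<Rightarrow> nat" where
    "rk v = (case v of None \<Rightarrow> 2 | Some (LIn j) \<Rightarrow> 0 | Some _ \<Rightarrow> 1)" for v
  let ?V = "insert None (Some ` literals n)"
  have fin: "finite (literals n)" by (simp add: literals_def)
  have ok: "dag_gate_ok ?basis n ?V rk g v" if "v \<in> ?V" for v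
  proof (cases v)
    case None
    have "rk (Some l) < rk None" for l by (auto simp: rk_def split: literal.splits)
    then show ?thesis using None assms by (auto simp: dag_gate_ok_def g_def rk_def)
  next
    case (Some l)
    then show ?thesis
      using that by (cases l) (auto simp: dag_gate_ok_def g_def rk_def literals_def)
  qed
  have top: "rk v \<le> rk None" for v
    by (auto simp: rk_def split: option.splits literal.splits)
  obtain C where C: "wf_circuit ?basis n C" "circuit_size C = (\<Sum>v\<in>?V. dag_gate_size (g v))"
      "circuit_depth C \<le> rk None"
    and out: "\<And>orc x val. (\<And>v. v \<in> ?V \<Longrightarrow> val v = dag_gate_value orc x val (g v)) \<Longrightarrow>
      circuit_output orc C x = val None"
    by (rule circuit_of_dag[of ?V None ?basis n rk g]) (use fin ok top in \<open>simp_all\<close>)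
  have card: "card (literals n) \<le> n + n + 2"
    unfolding literals_def
    using card_Un_le[of "LIn ` {..<n} \<union> LNot ` {..<n}" "{LConst True, LConst False}"]
      card_Un_le[of "LIn ` {..<n}" "LNot ` {..<n}"]
      card_image_le[of "{..<n}" LIn] card_image_le[of "{..<n}" LNot] by simp
  have small: "dag_gate_size (literal_gate l) \<le> 2" for l by (cases l) auto
  have "circuit_size C = dag_gate_size (g None) + (\<Sum>l\<in>literals n. dag_gate_size (g (Some l)))"
    unfolding C(2) using fin by (subst sum.insert) (auto simp: sum.reindex)
  also have "\<dots> \<le> (1 + length ls) + (\<Sum>l\<in>literals n. 2)"
    by (intro add_mono sum_mono) (simp_all add: g_def small)
  also have "\<dots> \<le> 4 * n + 5 + length ls" using card by simp
  finally have size: "circuit_size C \<le> 4 * n + 5 + length ls" .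
  have correct: "circuit_output orc C x = orc (map (literal_value x) ls)" for orc x
  proof -
    define val where "val v = (case v of None \<Rightarrow> orc (map (literal_value x) ls)
      | Some l \<Rightarrow> literal_value x l)" for v
    have "val v = dag_gate_value orc x val (g v)" for v
    proof (cases v)
      case (Some l)
      then show ?thesis by (cases l) (auto simp: val_def g_def)
    qed (simp add: val_def g_def comp_def)
    then show ?thesis using out[of val orc x] by (simp add: val_def)
  qed
  show ?thesis using that[OF C(1) size _ correct] C(3) by (simp add: rk_def)
qed

text \<open>This isolates the dependence on the input: all other entries can be hard-wired into the
  query.\<close>

lemma (in nor_net) entry_cong_ini:
  assumes "\<not> (\<exists>v<W. P = Gt 0 v \<and> Q = Tow (U + 4))"
  shows "entry P Q = nor_net.entry U W pr ini' P Q"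
proof -
  interpret other: nor_net U R L W pr ini' by unfold_locales (use W_less R_less pr_less in auto)
  show ?thesis using assms by (cases P; cases Q) auto
qed

text \<open>The literal for \<open>rail_init C x v = b\<close>; gate rails start as false, whence
  the constant.\<close>

definition rail_literal :: "circuit \<Rightarrow> bool \<Rightarrow> nat \<Rightarrow> literal" where
  "rail_literal C b v = (case C ! (v div 2) of
      Input j \<Rightarrow> if odd v = b then LIn j else LNot j | Gate t ws \<Rightarrow> LConst (\<not> b))"

lemma rail_literal_value: "literal_value x (rail_literal C b v) \<longleftrightarrow> rail_init C x v = b"
  by (auto simp: rail_literal_def rail_init_def split: gate.splits)

lemma rail_literal_in:
  assumes "wf_circuit basis n C" "v < 2 * length C"
  shows "rail_literal C b v \<in> literals n"
proof -
  have "v div 2 < length C" using assms(2) by simp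
  then show ?thesis
    using assms(1) by (auto simp: rail_literal_def literals_def wf_circuit_def split: gate.splits)
qed

text \<open>The query compares the final threshold with the true rail of the output gate. The
  promise holds for every input \<open>x\<close>, so each admissible oracle answers
  correctly.\<close>

lemma reduction_circuit:
  assumes wf: "wf_circuit {And_gate, Or_gate, Not_gate} n C" and k: "k \<ge> 1"
    and s: "s = length C" and D: "D = circuit_depth C"
    and U: "Suc (2 * s) < 2 ^ U" and R: "R < 2 ^ U" "U + 7 + 4 * D \<le> R ^ k"
    and N: "N = (U + 7 + 4 * D) + 2 ^ U + 2 ^ R + (2 * D + 1) * (2 * s + 1)"
  obtains C' where "wf_circuit {And_gate, Or_gate, Not_gate, Oracle_gate} n C'"
    and "circuit_size C' \<le> 4 * n + 5 + instance_length N" and "circuit_depth C' \<le> 2"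
    and "\<And>orc x. decides orc (comparison_problem k) \<Longrightarrow>
      circuit_output orc C' x = circuit_output orc' C x"
proof -
  \<comment> \<open>Two rounds per layer and two rails per gate.\<close>
  define L W where "L = 2 * D" and "W = 2 * s"
  have net: "nor_net U R W (rail_preds C)"
    by unfold_locales (use U R rail_preds_less[OF wf] in \<open>auto simp: W_def s\<close>)
  define V where "V = nor_net.nodes U R L W"
  define entry where "entry x = nor_net.entry U W (rail_preds C) (rail_init C x)" for x
  have finV: "finite V"
    unfolding V_def using nor_net.nodes_def[OF net] by simp
  obtain ns where ns: "set ns = V" "distinct ns" using finite_distinct_list[OF finV] by auto
  define M where "M = length ns"
  have M: "M = card V" using distinct_card[OF ns(2)] ns(1) by (simp add: M_def)
  have bij: "bij_betw ((!) ns) {..<M} V"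
    using ns by (intro bij_betw_nth) (auto simp: M_def)
  define out where "out = rail (s - 1) True"
  have "s \<noteq> 0" using wf by (auto simp: wf_circuit_def s)
  then have out_less: "out < W" by (simp add: out_def rail_def W_def)
  have "Gt L W \<in> V" "Gt L out \<in> V"
    unfolding V_def using nor_net.in_nodes[OF net] out_less by auto
  then obtain a b where a: "a < M" "ns ! a = Gt L W" and b: "b < M" "ns ! b = Gt L out"
    using ns by (metis M_def in_set_conv_nth)
  \<comment> \<open>\<open>p\<close> selects the bit for 1 or the bit for -1. Entries that do not
    depend on the input are computed with the dummy input \<open>[]\<close>.\<close>
  define lit where "lit p P Q = (case (P, Q) of
      (Gt l v, Tow j) \<Rightarrow> if l = 0 \<and> v < W \<and> j = U + 4 then rail_literal C p v
        else LConst (entry [] P Q = (if p then 1 else -1))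
    | _ \<Rightarrow> LConst (entry [] P Q = (if p then 1 else -1)))" for p P Q
  define ls where "ls =
    concat (map (\<lambda>P. concat (map (\<lambda>Q. [lit True (ns ! P) (ns ! Q), lit False (ns ! P) (ns ! Q)])
      [0..<M])) [0..<M]) @ map (\<lambda>P. LConst (P = a)) [0..<M] @ map (\<lambda>P. LConst (P = b)) [0..<M]"
  have lit_value: "literal_value x (lit p P Q) \<longleftrightarrow> entry x P Q = (if p then 1 else -1)" for x p P Q
  proof (cases "\<exists>v<W. P = Gt 0 v \<and> Q = Tow (U + 4)")
    case True
    then show ?thesis
      using nor_net.entry.simps[OF net] by (auto simp: lit_def entry_def rail_literal_value split: if_splits)
  next
    case False
    then have "lit p P Q = LConst (entry [] P Q = (if p then 1 else -1))"
      by (auto simp: lit_def split: net_node.splits)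
    moreover have "entry [] P Q = entry x P Q"
      unfolding entry_def by (rule nor_net.entry_cong_ini[OF net False])
    ultimately show ?thesis by simp
  qed
  have ls_value: "map (literal_value x) ls = encode_instance M (\<lambda>i j. entry x (ns ! i) (ns ! j)) a b" for x
    by (simp add: ls_def encode_instance_def encode_matrix_def encode_entry_def encode_node_def
        map_concat comp_def lit_value)
  have len: "length ls = instance_length M"
    using arg_cong[OF ls_value, of length] by (simp add: length_encode_instance)
  have "lit p P Q \<in> literals n" for p P Q
    using rail_literal_in[OF wf]
    by (auto simp: lit_def literals_def W_def s split: net_node.splits)
  then have "set ls \<subseteq> literals n"
    by (auto simp: ls_def) (auto simp: literals_def)
  then obtain C' where C': "wf_circuit {And_gate, Or_gate, Not_gate, Oracle_gate} n C'"
    "circuit_size C' \<le> 4 * n + 5 + length ls" "circuit_depth C' \<le> 2"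
    "\<And>orc x. circuit_output orc C' x = orc (map (literal_value x) ls)"
    by (rule oracle_circuit) blast
  have "M \<le> N"
    using nor_net.card_nodes_le[OF net, of L] by (simp add: M V_def N L_def W_def)
  then have "instance_length M \<le> instance_length N"
    using instance_length_strict_mono by (simp add: strict_mono_less_eq)
  then have size: "circuit_size C' \<le> 4 * n + 5 + instance_length N"
    using C'(2) len by simp
  have correct: "circuit_output orc C' x = circuit_output orc' C x"
    if orc: "decides orc (comparison_problem k)" for orc x
  proof -
    let ?\<delta> = "\<lambda>i j. entry x (ns ! i) (ns ! j)"
    interpret nor_net U R L W "rail_preds C" "rail_init C x" by (rule net)
    have V: "nodes = V" and ent: "nor_net.entry U W (rail_preds C) (rail_init C x) = entry x"
      by (simp_all add: V_def entry_def)
    interpret iso: circuit_iso "(!) ns" "{..<M}" V ?\<delta> "entry x"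
      by unfold_locales (use bij dag V ent in auto)
    have red: "reduced_circuit {..<M} ?\<delta>"
      using iso.reduced_circuit_iso reduced V ent by simp
    have "pc_depth {..<M} ?\<delta> \<le> pc_depth V (entry x)"
      using a by (intro iso.pc_depth_iso) auto
    also have "\<dots> \<le> U + 7 + 4 * D" using depth_nodes V ent by (simp add: L_def)
    also have "\<dots> \<le> R ^ k" by (rule R(2))
    finally have "real (pc_depth {..<M} ?\<delta>) \<le> real R ^ k" by (simp flip: of_nat_power)
    \<comment> \<open>Here the padding pays for the depth: there are at least \<open>2 ^ R\<close>
      nodes.\<close>
    also have "\<dots> \<le> log 2 (real M) ^ k"
      using card_nodes_ge V M by (intro power_mono le_log2_of_power) auto
    finally have input: "comparison_input k {..<M} ?\<delta> a b"
      using red a b by (simp add: comparison_input_def reduced_circuit_def)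
    then have "encode_instance M ?\<delta> a b \<in> promise (comparison_problem k)"
      by (auto simp: comparison_problem_def)
    then have "circuit_output orc C' x \<longleftrightarrow> node_eval {..<M} ?\<delta> a \<le> node_eval {..<M} ?\<delta> b"
      using orc encode_instance_in_language[OF input]
      by (simp add: C'(4) ls_value decides_def)
    also have "\<dots> \<longleftrightarrow> node_eval V (entry x) (Gt L W) \<le> node_eval V (entry x) (Gt L out)"
      using a b by (simp add: iso.node_eval_iso)
    also have "\<dots> \<longleftrightarrow> nor_rounds (rail_preds C) (rail_init C x) L out"
      using node_eval_threshold_le_iff[of L out] out_less V ent by simp
    also have "\<dots> \<longleftrightarrow> circuit_values orc' C x ! (s - 1) = True"
      unfolding out_def using \<open>s \<noteq> 0\<close> circuit_depth_ge[of "s - 1" C]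
      by (intro nor_rounds_correct[OF wf]) (auto simp: s L_def D)
    also have "\<dots> \<longleftrightarrow> circuit_output orc' C x"
      using circuit_output_nth[OF wf] by (simp add: s)
    finally show ?thesis .
  qed
  show ?thesis by (rule that[OF C'(1) size C'(3) correct])
qed

section \<open>Polynomial bounds and the choice of parameters\<close>

definition poly_bounded :: "(nat \<Rightarrow> nat) \<Rightarrow> bool" where
  "poly_bounded f \<longleftrightarrow> (\<exists>c. (\<lambda>n. real (f n)) \<in> O(\<lambda>n. real n ^ c))"

lemma poly_bounded_const: "poly_bounded (\<lambda>_. a)"
proof -
  have "(\<lambda>n. real a) \<in> O(\<lambda>n. real n ^ 0)" by simp
  then show ?thesis unfolding poly_bounded_def by blast
qed

lemma poly_bounded_ident: "poly_bounded (\<lambda>n. n)"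
proof -
  have "(\<lambda>n. real n) \<in> O(\<lambda>n. real n ^ 1)" by simp
  then show ?thesis unfolding poly_bounded_def by blast
qed

lemma poly_bounded_mult:
  assumes "poly_bounded f" "poly_bounded g"
  shows "poly_bounded (\<lambda>n. f n * g n)"
proof -
  obtain c d where "(\<lambda>n. real (f n)) \<in> O(\<lambda>n. real n ^ c)" "(\<lambda>n. real (g n)) \<in> O(\<lambda>n. real n ^ d)"
    using assms by (auto simp: poly_bounded_def)
  then have "(\<lambda>n. real (f n) * real (g n)) \<in> O(\<lambda>n. real n ^ c * real n ^ d)"
    by (rule landau_o.big.mult)
  then show ?thesis unfolding poly_bounded_def by (auto simp flip: power_add)
qed

lemma poly_bounded_add:
  assumes "poly_bounded f" "poly_bounded g"
  shows "poly_bounded (\<lambda>n. f n + g n)"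
proof -
  obtain c d where c: "(\<lambda>n. real (f n)) \<in> O(\<lambda>n. real n ^ c)" and d: "(\<lambda>n. real (g n)) \<in> O(\<lambda>n. real n ^ d)"
    using assms by (auto simp: poly_bounded_def)
  have mono: "(\<lambda>n. real n ^ i) \<in> O(\<lambda>n. real n ^ (i + j))" for i j
    by (rule bigoI[of _ 1], rule eventually_sequentiallyI[of 1])
      (auto intro: power_increasing)
  have "(\<lambda>n. real (f n)) \<in> O(\<lambda>n. real n ^ (c + d))"
    using c mono[of c d] by (rule landau_o.big_trans)
  moreover have "(\<lambda>n. real (g n)) \<in> O(\<lambda>n. real n ^ (c + d))"
    using d mono[of d c] by (subst add.commute) (rule landau_o.big_trans)
  ultimately have "(\<lambda>n. real (f n) + real (g n)) \<in> O(\<lambda>n. real n ^ (c + d))"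
    by (rule sum_in_bigo)
  then show ?thesis unfolding poly_bounded_def by auto
qed

lemma poly_bounded_mono:
  assumes "poly_bounded g" "eventually (\<lambda>n. f n \<le> g n) sequentially"
  shows "poly_bounded f"
proof -
  obtain c where c: "(\<lambda>n. real (g n)) \<in> O(\<lambda>n. real n ^ c)"
    using assms(1) by (auto simp: poly_bounded_def)
  have "(\<lambda>n. real (f n)) \<in> O(\<lambda>n. real (g n))"
    using assms(2) by (intro bigoI[of _ 1]) (auto elim: eventually_mono)
  then show ?thesis using c landau_o.big_trans unfolding poly_bounded_def by blast
qed

lemma poly_bounded_log:
  assumes "poly_bounded f" and "\<And>n. 2 ^ g n \<le> f n"
  obtains c where "eventually (\<lambda>n. real (g n) \<le> c * log 2 (real n)) sequentially"
proof -
  obtain d where "(\<lambda>n. real (f n)) \<in> O(\<lambda>n. real n ^ d)"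
    using assms(1) by (auto simp: poly_bounded_def)
  then obtain a where a: "a > 0" "eventually (\<lambda>n. norm (real (f n)) \<le> a * norm (real n ^ d)) sequentially"
    by (rule landau_o.bigE)
  \<comment> \<open>The constant term \<open>log 2 a\<close> is absorbed, as
    \<open>log 2 n \<ge> 1\<close> from 2 on.\<close>
  have "eventually (\<lambda>n. real (g n) \<le> (\<bar>log 2 a\<bar> + d) * log 2 (real n)) sequentially"
    using a(2) eventually_ge_at_top[of 2]
  proof eventually_elim
    case (elim n)
    have "real (g n) = log 2 (2 ^ g n)" by simp
    also have "\<dots> \<le> log 2 (a * real n ^ d)"
    proof (rule log_mono)
      have "(2::real) ^ g n \<le> real (f n)"
        using assms(2)[of n] by (metis of_nat_le_iff of_nat_numeral of_nat_power)
      also have "real (f n) \<le> a * real n ^ d" using elim by simp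
      finally show "2 ^ g n \<le> a * real n ^ d" .
    qed simp_all
    also have "\<dots> = log 2 a + real d * log 2 (real n)"
      using a(1) elim by (simp add: log_mult log_nat_power)
    also have "\<dots> \<le> \<bar>log 2 a\<bar> * log 2 (real n) + real d * log 2 (real n)"
    proof -
      have "1 \<le> log 2 (real n)" using elim by simp
      then have "\<bar>log 2 a\<bar> * 1 \<le> \<bar>log 2 a\<bar> * log 2 (real n)" by (intro mult_left_mono) auto
      then show ?thesis by linarith
    qed
    finally show ?case by (simp add: algebra_simps)
  qed
  then show ?thesis by (rule that)
qed

lemma poly_bounded_power2:
  assumes "eventually (\<lambda>n. real (g n) \<le> c * log 2 (real n)) sequentially"
  shows "poly_bounded (\<lambda>n. 2 ^ g n)"
proof -
  define d where "d = nat \<lceil>c\<rceil>"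
  have "eventually (\<lambda>n. norm (real (2 ^ g n)) \<le> 1 * norm (real n ^ d)) sequentially"
    using assms eventually_ge_at_top[of 1]
  proof eventually_elim
    case (elim n)
    have "c \<le> real d" unfolding d_def by linarith
    then have "c * log 2 (real n) \<le> real d * log 2 (real n)"
      using log2_nat_nonneg[of n] by (intro mult_right_mono) auto
    then have "2 powr real (g n) \<le> 2 powr (log 2 (real n) * real d)"
      using elim by (simp add: mult.commute)
    also have "\<dots> = real n ^ d"
      using elim by (simp add: powr_powr[symmetric] powr_realpow)
    finally show ?case by (simp add: powr_realpow)
  qed
  then have "(\<lambda>n. real (2 ^ g n)) \<in> O(\<lambda>n. real n ^ d)" by (rule bigoI)
  then show ?thesis by (auto simp: poly_bounded_def)
qed

text \<open>Padding: the instance must have at least \<open>2 ^ R\<close> nodes where \<open>R ^ k\<close> bounds the depth.\<close>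

lemma reduction_parameters:
  assumes k: "k \<ge> 1" and s: "poly_bounded s"
    and D: "(\<lambda>n. real (D n)) \<in> O(\<lambda>n. log 2 (real n) ^ k)"
  obtains U R where "\<And>n. Suc (2 * s n) < 2 ^ U n" "\<And>n. R n < 2 ^ U n" "\<And>n. U n + 7 + 4 * D n \<le> R n ^ k"
    and "poly_bounded (\<lambda>n. 2 ^ U n)" "poly_bounded (\<lambda>n. 2 ^ R n)" "poly_bounded D" "poly_bounded U"
proof -
  obtain a where a: "a > 0" "eventually (\<lambda>n. norm (real (D n)) \<le> a * norm (log 2 (real n) ^ k)) sequentially"
    using D by (rule landau_o.bigE)
  have D_le: "eventually (\<lambda>n. real (D n) \<le> a * log 2 (real n) ^ k) sequentially"
    using a(2) by eventually_elim (use log2_nat_nonneg in \<open>simp add: power_abs\<close>)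
  have "(\<lambda>n. log 2 (real n) ^ k) \<in> O(\<lambda>n. real n ^ k)"
    using log2_nat_nonneg log2_nat_le
    by (intro bigoI[of _ 1] always_eventually) (auto simp: power_abs intro!: power_mono)
  then have pD: "poly_bounded D"
    using D landau_o.big_trans unfolding poly_bounded_def by blast
  \<comment> \<open>If \<open>2 ^ U \<ge> Y\<close>, half of \<open>2 ^ U\<close> bounds
    \<open>U\<close> and the other half exceeds \<open>7 + 4 * D\<close>, so
    \<open>H < 2 ^ U\<close>; the bound on \<open>2 * s\<close> comes along.\<close>
  define Y where "Y n = 2 * (2 * s n + 4 * D n + 9)" for n
  have pY: "poly_bounded (\<lambda>n. 2 * Y n)"
    unfolding Y_def using s pD
    by (intro poly_bounded_add poly_bounded_mult poly_bounded_const)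
  \<comment> \<open>Minimality keeps \<open>2 ^ U\<close> within twice the polynomial
    \<open>Y\<close>.\<close>
  define U where "U n = (LEAST u. Y n \<le> 2 ^ u)" for n
  have YU: "Y n \<le> 2 ^ U n" for n
    unfolding U_def by (rule LeastI[of _ "Y n"]) (simp add: less_imp_le)
  have U_pos: "U n \<noteq> 0" for n
    using YU[of n] by (intro notI) (simp add: Y_def)
  have half: "(2::nat) ^ U n = 2 * 2 ^ (U n - 1)" for n
    using U_pos[of n] by (cases "U n") auto
  have UY: "2 ^ U n \<le> 2 * Y n" for n
  proof -
    have "\<not> Y n \<le> 2 ^ (U n - 1)"
      using not_less_Least[of "U n - 1" "\<lambda>u. Y n \<le> 2 ^ u"] U_pos[of n] by (simp add: U_def)
    then show ?thesis using half[of n] by simp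
  qed
  define H where "H n = U n + 7 + 4 * D n" for n
  have HU: "H n < 2 ^ U n" for n
  proof -
    obtain u where u: "U n = Suc u" using U_pos[of n] by (cases "U n") auto
    have "u < a \<Longrightarrow> 2 * (2 * s n + 4 * D n + 9) \<le> 2 * a \<Longrightarrow> Suc u + 7 + 4 * D n < 2 * a" for a
      by (simp add: algebra_simps)
    from this[OF less_exp] show ?thesis using YU[of n] by (simp add: Y_def H_def u)
  qed
  \<comment> \<open>By minimality \<open>(R - 1)^k < H\<close>, and \<open>H\<close> is
    \<open>O(log^k n)\<close>; hence \<open>R\<close> is \<open>O(log n)\<close> and
    \<open>2 ^ R\<close> is polynomial.\<close>
  define R where "R n = (LEAST r. H n \<le> r ^ k)" for n
  have HH: "H n \<le> H n ^ k" for n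
    using k by (intro self_le_power) (auto simp: H_def)
  have HR: "H n \<le> R n ^ k" for n
    unfolding R_def using HH by (rule LeastI)
  have RU: "R n < 2 ^ U n" for n
  proof -
    have "R n \<le> H n" unfolding R_def using HH by (rule Least_le)
    then show ?thesis using HU[of n] by simp
  qed
  have R_pos: "R n \<noteq> 0" for n
    using HR[of n] k by (intro notI) (simp add: H_def power_0_left)
  have R_pred: "(R n - 1) ^ k < H n" for n
    using not_less_Least[of "R n - 1" "\<lambda>r. H n \<le> r ^ k"] R_pos[of n] by (simp add: R_def)
  have pU2: "poly_bounded (\<lambda>n. 2 ^ U n)"
    by (rule poly_bounded_mono[OF pY]) (use UY in auto)
  have pU: "poly_bounded U"
    by (rule poly_bounded_mono[OF pU2]) (auto simp: less_imp_le)
  obtain b where b: "eventually (\<lambda>n. real (U n) \<le> b * log 2 (real n)) sequentially"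
    using poly_bounded_log[OF pY UY] .
  define e where "e = \<bar>b\<bar> + 7 + 4 * a"
  have "eventually (\<lambda>n. real (R n) \<le> (e + 1) * log 2 (real n)) sequentially"
    using D_le b eventually_ge_at_top[of 2]
  proof eventually_elim
    case (elim n)
    let ?l = "log 2 (real n)"
    have l: "1 \<le> ?l" using elim by simp
    have lk: "?l \<le> ?l ^ k" using l k by (intro self_le_power) auto
    have e: "1 \<le> e" using a(1) by (simp add: e_def)
    have "b * ?l \<le> \<bar>b\<bar> * ?l ^ k"
      using l lk by (intro mult_mono) auto
    moreover have "real (H n) = real (U n) + 7 + 4 * real (D n)" by (simp add: H_def)
    ultimately have "real (H n) \<le> \<bar>b\<bar> * ?l ^ k + 7 * ?l ^ k + 4 * (a * ?l ^ k)"
      using elim(1,2) l lk by linarith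
    also have "\<dots> = e * ?l ^ k" by (simp add: e_def algebra_simps)
    \<comment> \<open>Raising \<open>e \<ge> 1\<close> to the power \<open>k\<close> allows the
      comparison of \<open>k\<close>-th roots.\<close>
    also have "\<dots> \<le> e ^ k * ?l ^ k"
      using e k l by (intro mult_right_mono self_le_power) auto
    also have "\<dots> = (e * ?l) ^ k" by (simp add: power_mult_distrib)
    finally have "real (H n) \<le> (e * ?l) ^ k" .
    moreover have "real (R n - 1) ^ k < real (H n)"
      using R_pred[of n] by (simp flip: of_nat_power)
    ultimately have "real (R n - 1) ^ k < (e * ?l) ^ k" by linarith
    then have "real (R n - 1) < e * ?l"
      by (rule power_less_imp_less_base) (use e l in auto)
    then show ?case using l by (simp add: algebra_simps)
  qed
  then have pR: "poly_bounded (\<lambda>n. 2 ^ R n)" by (rule poly_bounded_power2)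
  have "Suc (2 * s n) < 2 ^ U n" for n using YU[of n] by (simp add: Y_def)
  then show ?thesis
    by (rule that[of U R, OF _ RU HR[unfolded H_def] pU2 pR pD pU])
qed

lemma comparison_problem_hard:
  assumes k: "k \<ge> 1"
  shows "AC0_hard_for (AC k) (comparison_problem k)"
  unfolding AC0_hard_for_def
proof
  let ?basis = "{And_gate, Or_gate, Not_gate, Oracle_gate}"
  fix K assume "K \<in> AC k"
  then obtain F where F: "circuit_family {And_gate, Or_gate, Not_gate} k F"
    and dec: "decides (family_output (\<lambda>_. False) F) K"
    by (auto simp: AC_def)
  have wf: "wf_circuit {And_gate, Or_gate, Not_gate} n (F n)" for n
    using F by (simp add: circuit_family_def)
  define s where "s n = length (F n)" for n
  define D where "D n = circuit_depth (F n)" for n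
  have "poly_bounded (\<lambda>n. circuit_size (F n))"
    using F by (simp add: circuit_family_def poly_bounded_def)
  then have ps: "poly_bounded s"
    by (rule poly_bounded_mono) (simp add: s_def length_le_circuit_size)
  have "(\<lambda>n. real (D n)) \<in> O(\<lambda>n. log 2 (real n) ^ k)"
    using F by (simp add: circuit_family_def D_def)
  then obtain U R where U: "\<And>n. Suc (2 * s n) < 2 ^ U n"
    and R: "\<And>n. R n < 2 ^ U n" "\<And>n. U n + 7 + 4 * D n \<le> R n ^ k"
    and p: "poly_bounded (\<lambda>n. 2 ^ U n)" "poly_bounded (\<lambda>n. 2 ^ R n)" "poly_bounded D" "poly_bounded U"
    using reduction_parameters[OF k ps] by blast
  define N where "N n = (U n + 7 + 4 * D n) + 2 ^ U n + 2 ^ R n + (2 * D n + 1) * (2 * s n + 1)" for n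
  \<comment> \<open>The circuit is chosen before the oracle, as the reducibility notion for promise
    problems demands.\<close>
  have "\<exists>C. wf_circuit ?basis n C \<and> circuit_size C \<le> 4 * n + 5 + instance_length (N n) \<and>
      circuit_depth C \<le> 2 \<and> (\<forall>orc x. decides orc (comparison_problem k) \<longrightarrow>
        circuit_output orc C x = circuit_output (\<lambda>_. False) (F n) x)" for n
    by (rule reduction_circuit[OF wf[of n] k s_def[of n] D_def[of n] U[of n] R(1)[of n] R(2)[of n] N_def[of n]])
      blast
  then obtain F' where wf': "\<And>n. wf_circuit ?basis n (F' n)"
    and size: "\<And>n. circuit_size (F' n) \<le> 4 * n + 5 + instance_length (N n)"
    and depth: "\<And>n. circuit_depth (F' n) \<le> 2"
    and out: "\<And>n orc x. decides orc (comparison_problem k) \<Longrightarrow>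
      circuit_output orc (F' n) x = circuit_output (\<lambda>_. False) (F n) x"
    by metis
  have pN: "poly_bounded N"
    unfolding N_def using p ps by (intro poly_bounded_add poly_bounded_mult poly_bounded_const)
  have "poly_bounded (\<lambda>n. 4 * n + 5 + instance_length (N n))"
    unfolding instance_length_def
    using pN by (intro poly_bounded_add poly_bounded_mult poly_bounded_const poly_bounded_ident)
  then have "poly_bounded (\<lambda>n. circuit_size (F' n))"
    by (rule poly_bounded_mono) (simp add: size)
  moreover have "(\<lambda>n. real (circuit_depth (F' n))) \<in> O(\<lambda>n. log 2 (real n) ^ 0)"
    using depth by (intro bigoI[of _ 2] always_eventually) simp
  ultimately have "circuit_family ?basis 0 F'"
    using wf' by (simp add: circuit_family_def poly_bounded_def)
  moreover have "decides (family_output orc F') K" if "decides orc (comparison_problem k)" for orc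
    using dec out[OF that] by (simp add: decides_def family_output_def)
  ultimately show "AC0_Turing_reducible K (comparison_problem k)"
    unfolding AC0_Turing_reducible_def by blast
qed

theorem corollary54:
  fixes k :: nat
  assumes "k \<ge> 1"
  shows "comparison_problem k \<in> TC k \<and> AC0_hard_for (AC k) (comparison_problem k)"
  using comparison_problem_in_TC comparison_problem_hard[OF assms] by blast

end
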